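(* There exists an absolute constant $C>0$ such that for every integer $m\ge 2$, every $0<\varepsilon\le 1/2$ and every $n$, there is an (adaptive) one-sided $\varepsilon$-test for $\mathcal{S}_m$ over $\{0,1\}^n$ in the Huge Object model that makes at most $C\,\varepsilon^{-1} m\log m\cdot\min\{\log\varepsilon^{-1},\log m\}$ queries.
   Context: Huge Object model: the input is an unknown distribution $P$ over $\{0,1\}^n$. An algorithm may draw independent samples from $P$ and may only query individual bits of drawn samples, choosing each step adaptively based on previous answers; its query complexity is the total number of bit queries. $d_H(u,v)=\frac1n|\{i:u_i\ne v_i\}|$; for distributions $P,Q$ over $\{0,1\}^n$, $d(P,Q)=\min_T\mathbb{E}_{(u,v)\sim T}[d_H(u,v)]$ over couplings $T$ of $P,Q$. $\mathcal{S}_m$ is the set of distributions supported on at most $m$ elements; $P$ is $\varepsilon$-far from $\mathcal{S}_m$ if $\min_{Q\in\mathcal{S}_m}d(P,Q)>\varepsilon$. A one-sided $\varepsilon$-test for $\mathcal{S}_m$ accepts every $P\in\mathcal{S}_m$ with probability $1$ and rejects every $P$ that is $\varepsilon$-far from $\mathcal{S}_m$ with probability greater than $2/3$. *)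

theory Defs
  imports "HOL-Probability.Probability" "HOL-Probability.Product_PMF"
begin

text \<open>Elements of $\{0,1\}^n$ are Boolean lists of length \<open>n\<close>.\<close>

definition distributions :: "nat \<Rightarrow> bool list pmf set" where
  "distributions n = {P. set_pmf P \<subseteq> {u. length u = n}}"

text \<open>\<open>card\<close> is the true cardinality below: a member of \<open>distributions n\<close> has finite support.\<close>

definition supported_on_at_most :: "nat \<Rightarrow> nat \<Rightarrow> bool list pmf set" where
  "supported_on_at_most n m = {P \<in> distributions n. card (set_pmf P) \<le> m}"

definition hamming_dist :: "nat \<Rightarrow> bool list \<Rightarrow> bool list \<Rightarrow> real" where
  "hamming_dist n u v = real (card {i. i < n \<and> u ! i \<noteq> v ! i}) / real n"

definition couplings :: "'a pmf \<Rightarrow> 'b pmf \<Rightarrow> ('a \<times> 'b) pmf set" where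
  "couplings P Q = {T. map_pmf fst T = P \<and> map_pmf snd T = Q}"

text \<open>
  Both minima (over couplings, and over the members of the property) are written as infima of
  sets of reals that are bounded below by 0. They are over nonempty sets: \<open>pair_pmf P Q\<close> is a
  coupling, and \<open>supported_on_at_most n m\<close> is nonempty for \<open>m \<ge> 1\<close>. By compactness they are
  attained for distributions over $\{0,1\}^n$ and this property.
\<close>

definition emd :: "nat \<Rightarrow> bool list pmf \<Rightarrow> bool list pmf \<Rightarrow> real" where
  "emd n P Q =
     (INF T\<in>couplings P Q. measure_pmf.expectation T (\<lambda>(u, v). hamming_dist n u v))"

definition far_from :: "nat \<Rightarrow> real \<Rightarrow> bool list pmf set \<Rightarrow> bool list pmf \<Rightarrow> bool" where
  "far_from n \<epsilon> S P \<longleftrightarrow> (INF Q\<in>S. emd n P Q) > \<epsilon>"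

text \<open>
  A deterministic adaptive algorithm is a decision tree. The node \<open>Query j i t0 t1\<close> queries bit
  \<open>i\<close> of sample \<open>j\<close> and continues with \<open>t0\<close> on answer 0 and with \<open>t1\<close> on answer 1;
  \<open>Answer True\<close> means accept.
\<close>

datatype dtree = Answer bool | Query nat nat dtree dtree

primrec run :: "dtree \<Rightarrow> (nat \<Rightarrow> bool list) \<Rightarrow> bool" where
  "run (Answer b) x = b"
| "run (Query j i t0 t1) x = (if x j ! i then run t1 x else run t0 x)"

primrec queries_within :: "nat \<Rightarrow> nat \<Rightarrow> dtree \<Rightarrow> bool" where
  "queries_within s n (Answer b) \<longleftrightarrow> True"
| "queries_within s n (Query j i t0 t1) \<longleftrightarrow>
     j < s \<and> i < n \<and> queries_within s n t0 \<and> queries_within s n t1"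

primrec depth :: "dtree \<Rightarrow> nat" where
  "depth (Answer b) = 0"
| "depth (Query j i t0 t1) = Suc (max (depth t0) (depth t1))"

text \<open>
  A randomized algorithm consists of the number \<open>s\<close> of samples it draws and a distribution over
  decision trees (its internal randomness, independent of the samples). Drawing samples on the
  fly would give nothing more: only bits of samples are observable, and an algorithm making
  at most \<open>q\<close> queries looks at no more than \<open>q\<close> samples.
\<close>

type_synonym algorithm = "nat \<times> dtree pmf"

definition is_algorithm :: "nat \<Rightarrow> algorithm \<Rightarrow> bool" where
  "is_algorithm n A \<longleftrightarrow> (\<forall>t\<in>set_pmf (snd A). queries_within (fst A) n t)"

text \<open>
  Worst case over the input, the samples and the internal randomness.
\<close>

definition makes_at_most_queries :: "algorithm \<Rightarrow> real \<Rightarrow> bool" where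
  "makes_at_most_queries A q \<longleftrightarrow> (\<forall>t\<in>set_pmf (snd A). real (depth t) \<le> q)"

definition outcome :: "algorithm \<Rightarrow> bool list pmf \<Rightarrow> bool pmf" where
  "outcome A P = do {
     t \<leftarrow> snd A;
     x \<leftarrow> Pi_pmf {..<fst A} [] (\<lambda>_. P);
     return_pmf (run t x)
   }"

definition one_sided_test ::
    "nat \<Rightarrow> real \<Rightarrow> bool list pmf set \<Rightarrow> algorithm \<Rightarrow> bool" where
  "one_sided_test n \<epsilon> S A \<longleftrightarrow>
     is_algorithm n A \<and>
     (\<forall>P\<in>S. pmf (outcome A P) True = 1) \<and>
     (\<forall>P\<in>distributions n. far_from n \<epsilon> S P \<longrightarrow> pmf (outcome A P) False > 2 / 3)"

end

theory Submission
  imports Defs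
begin

text \<open>
  The test collects samples that it knows to be pairwise distinct and rejects once it has more than
  \<open>m\<close> of them, so its error is one-sided. If \<open>P\<close> is \<open>\<epsilon>\<close>-far, then the expected
  distance of a new sample from any set of at most \<open>m\<close> representatives exceeds \<open>\<epsilon>\<close>,
  since moving every point to its nearest representative is a transport plan. Splitting this
  expectation dyadically, a proportion \<open>2 ^ -j\<close> of \<open>O(m / \<epsilon>)\<close> samples is read on
  \<open>O(2 ^ j log m)\<close> random indices, which detects distances above \<open>2 ^ -(j + 1)\<close>. Every
  level costs \<open>O(\<epsilon>^-1 m log m)\<close>, and \<open>O(log \<epsilon>^-1)\<close> levels suffice. If
  \<open>1 / \<epsilon> > m\<close>, only \<open>O(log m)\<close> levels are kept, and the contribution of distances below
  \<open>1 / m\<close> is caught by \<open>O(1 / \<epsilon>)\<close> samples that are first matched with a single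
  candidate on at most \<open>m\<close> indices and then compared with it on \<open>O(m)\<close> fresh random indices.
  The expected number of representatives equals the expected sum of the conditional acceptance
  probabilities; this sum exceeds \<open>10 (m + 1)\<close> whenever at most \<open>m\<close> representatives are
  found, so by Markov's inequality this rarely happens.
\<close>

section \<open>Decision trees\<close>

text \<open>The obstacle is the cost of comparing a sample with up to \<open>m\<close>
  representatives. At the levels, all samples use prefixes of one index list: with repeated queries
  free, the representatives cost at most \<open>Suc m * (2 ^ L * K)\<close> bits altogether, and
  each further sample pays only for its own prefix. The price is dependence: which samples become
  representatives depends on the list on which they are compared. The analysis therefore fixes the
  samples, runs a selection by true distances, and draws the list last. During probing the indices
  are fresh, so no such detour is needed, but a sample can afford only one candidate. The list
  \<open>D\<close> provides it: each new representative adds at most one index, and any two differ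
  on \<open>D\<close>, so a string agrees on \<open>D\<close> with at most one of them. Matching
  costs at most \<open>Suc m\<close> bits, so about \<open>m\<close> fresh indices are affordable as
  well, and the levels may stop near distance \<open>1 / m\<close>: a probe then detects a distance
  \<delta> below that with probability of order \<open>m * \<delta>\<close>, and
  \<open>O(1 / \<epsilon>)\<close> probes of cost \<open>O(m)\<close> suffice.\<close>

primrec queried :: "dtree \<Rightarrow> (nat \<Rightarrow> bool list) \<Rightarrow> (nat \<times> nat) set" where
  "queried (Answer b) x = {}"
| "queried (Query j i t0 t1) x = insert (j, i) (if x j ! i then queried t1 x else queried t0 x)"

text \<open>
  Remembering answers makes repeated queries free, so only the number of distinct queries matters.
\<close>

primrec memo :: "dtree \<Rightarrow> (nat \<times> nat \<rightharpoonup> bool) \<Rightarrow> dtree" where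
  "memo (Answer b) c = Answer b"
| "memo (Query j i t0 t1) c =
     (case c (j, i) of
        None \<Rightarrow> Query j i (memo t0 (c((j, i) \<mapsto> False))) (memo t1 (c((j, i) \<mapsto> True)))
      | Some b \<Rightarrow> if b then memo t1 c else memo t0 c)"

lemma finite_queried [simp]: "finite (queried t x)"
  by (induction t) auto

lemma queries_within_memo: "queries_within s n t \<Longrightarrow> queries_within s n (memo t c)"
  by (induction t arbitrary: c) (auto split: option.split)

definition consistent :: "(nat \<times> nat \<rightharpoonup> bool) \<Rightarrow> (nat \<Rightarrow> bool list) \<Rightarrow> bool" where
  "consistent c x \<longleftrightarrow> (\<forall>j i b. c (j, i) = Some b \<longrightarrow> x j ! i = b)"

lemma consistent_upd: "consistent c x \<Longrightarrow> x j ! i = b \<Longrightarrow> consistent (c((j, i) \<mapsto> b)) x"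
  by (auto simp: consistent_def)

lemma run_memo: "consistent c x \<Longrightarrow> run (memo t c) x = run t x"
proof (induction t arbitrary: c)
  case (Query j i t0 t1)
  show ?case
  proof (cases "c (j, i)")
    case None
    then show ?thesis
      using Query.IH consistent_upd[OF Query.prems, of j i True] consistent_upd[OF Query.prems, of j i False]
      by (cases "x j ! i") simp_all
  next
    case (Some b)
    then have "x j ! i = b" using Query.prems by (auto simp: consistent_def)
    then show ?thesis using Some Query by auto
  qed
qed simp

text \<open>A longest path of the memoised tree never asks for a known bit, so its answers cannot
  contradict each other and some actual input \<open>x\<close> follows it. Its length then counts
  distinct queries on \<open>x\<close>.\<close>

lemma depth_memo:
  assumes "queries_within s n t"
    and "\<exists>x. consistent c x \<and> (\<forall>j. length (x j) = n)"
  shows "\<exists>x. consistent c x \<and> (\<forall>j. length (x j) = n) \<and> depth (memo t c) \<le> card (queried t x - dom c)"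
  using assms
proof (induction t arbitrary: c)
  case (Query j i t0 t1)
  from Query.prems have i: "i < n" by simp
  show ?case
  proof (cases "c (j, i)")
    case (Some b)
    define t where "t = (if b then t1 else t0)"
    have "\<exists>x. consistent c x \<and> (\<forall>j. length (x j) = n) \<and> depth (memo t c) \<le> card (queried t x - dom c)"
      using Query by (auto simp: t_def)
    then obtain x where x: "consistent c x" "\<forall>j. length (x j) = n"
      "depth (memo t c) \<le> card (queried t x - dom c)" by blast
    have "x j ! i = b" using x Some by (auto simp: consistent_def)
    moreover have "insert (j, i) (queried t x) - dom c = queried t x - dom c"
      using Some by auto
    ultimately show ?thesis
      using x Some by (intro exI[of _ x]) (auto simp: t_def)
  next
    case None
    obtain x0 where x0: "consistent c x0" "\<forall>j. length (x0 j) = n" using Query.prems by blast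
    \<comment> \<open>Either answer to an unknown bit is realised by overwriting it;
      \<open>i < n\<close> matters because a list update out of range changes nothing.\<close>
    have *: "\<exists>x. consistent (c((j, i) \<mapsto> b)) x \<and> (\<forall>j. length (x j) = n)" for b
    proof (intro exI conjI)
      show "consistent (c((j, i) \<mapsto> b)) (x0(j := (x0 j)[i := b]))"
        using x0 None i by (auto simp: consistent_def nth_list_update)
      show "\<forall>k. length ((x0(j := (x0 j)[i := b])) k) = n" using x0 by auto
    qed
    have **: "\<exists>x. consistent c x \<and> (\<forall>j. length (x j) = n) \<and>
            Suc (depth (memo t (c((j, i) \<mapsto> b)))) \<le> card (queried (Query j i t0 t1) x - dom c)"
      if t: "t = (if b then t1 else t0)" for t b
    proof -
      have "\<exists>x. consistent (c((j, i) \<mapsto> b)) x \<and> (\<forall>j. length (x j) = n) \<and>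
          depth (memo t (c((j, i) \<mapsto> b))) \<le> card (queried t x - dom (c((j, i) \<mapsto> b)))"
        unfolding t using Query.IH(1)[OF _ *[of b]] Query.IH(2)[OF _ *[of b]] Query.prems(1)
        by (cases b) (simp_all del: dom_fun_upd fun_upd_apply)
      then obtain x where x: "consistent (c((j, i) \<mapsto> b)) x" "\<forall>j. length (x j) = n"
        "depth (memo t (c((j, i) \<mapsto> b))) \<le> card (queried t x - dom (c((j, i) \<mapsto> b)))" by blast
      have b: "x j ! i = b" using x by (auto simp: consistent_def)
      have "queried (Query j i t0 t1) x - dom c = insert (j, i) (queried t x - dom (c((j, i) \<mapsto> b)))"
        using b None by (auto simp: t)
      then have "card (queried (Query j i t0 t1) x - dom c) = Suc (card (queried t x - dom (c((j, i) \<mapsto> b))))"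
        by simp
      moreover have "consistent c x" using x(1) None
        unfolding consistent_def by (metis fun_upd_other option.distinct(1))
      ultimately show ?thesis using x by (intro exI[of _ x]) simp
    qed
    define d0 where "d0 = depth (memo t0 (c((j, i) \<mapsto> False)))"
    define d1 where "d1 = depth (memo t1 (c((j, i) \<mapsto> True)))"
    have "depth (memo (Query j i t0 t1) c) = Suc (max d0 d1)" using None by (simp add: d0_def d1_def)
    then have "depth (memo (Query j i t0 t1) c) = Suc d0 \<or> depth (memo (Query j i t0 t1) c) = Suc d1"
      by (simp add: max_def)
    then show ?thesis
      using **[of t0 False] **[of t1 True] unfolding d0_def d1_def by auto
  qed
qed auto

text \<open>This turns an amortised count of distinct queries into the worst-case depth demanded by
  \<open>makes_at_most_queries\<close>.\<close>

lemma ex_depth_le_card_queried: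
  assumes "queries_within s n t"
    and "\<And>x. card (queried t x) \<le> q"
  shows "\<exists>t'. queries_within s n t' \<and> depth t' \<le> q \<and> run t' = run t"
proof (intro exI conjI)
  have "\<exists>x. consistent Map.empty x \<and> (\<forall>j. length (x j) = n)"
    by (intro exI[of _ "\<lambda>_. replicate n False"]) (auto simp: consistent_def)
  from depth_memo[OF assms(1) this] obtain x where "depth (memo t Map.empty) \<le> card (queried t x)"
    by auto
  with assms(2)[of x] show "depth (memo t Map.empty) \<le> q" by simp
  show "run (memo t Map.empty) = run t"
    by (intro ext run_memo) (auto simp: consistent_def)
qed (use assms(1) queries_within_memo in auto)

lemma find_SomeD: "find P xs = Some y \<Longrightarrow> y \<in> set xs \<and> P y"
  by (auto simp: find_Some_iff)

section \<open>The two selection procedures and their decision trees\<close>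

definition agree :: "nat list \<Rightarrow> bool list \<Rightarrow> bool list \<Rightarrow> bool" where
  "agree J u w \<longleftrightarrow> (\<forall>i\<in>set J. u ! i = w ! i)"

text \<open>The type \<open>'a\<close> has two uses: sample numbers with \<open>v\<close> giving
  their values, as in the trees, and strings with \<open>v = id\<close>, as in the analysis. A
  sample differing on \<open>D\<close> from every representative is new for certain; otherwise only
  the candidate found by \<open>D\<close> is tested on \<open>S\<close>, and a difference found
  there joins \<open>D\<close>. More than \<open>m\<close> representatives freeze the state, which
  caps their number at \<open>Suc m\<close>.\<close>

definition probe_step ::
    "nat \<Rightarrow> ('a \<Rightarrow> bool list) \<Rightarrow> nat list \<times> 'a \<Rightarrow> 'a list \<times> nat list \<Rightarrow> 'a list \<times> nat list" where
  "probe_step m v = (\<lambda>(S, y) (R, D).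
     if m < length R then (R, D)
     else case find (\<lambda>z. agree D (v y) (v z)) R of
       None \<Rightarrow> (y # R, D)
     | Some z \<Rightarrow> (case find (\<lambda>i. v y ! i \<noteq> v z ! i) S of
         None \<Rightarrow> (R, D)
       | Some i \<Rightarrow> (y # R, i # D)))"

definition level_step ::
    "nat \<Rightarrow> ('a \<Rightarrow> bool list) \<Rightarrow> nat list \<times> 'a \<Rightarrow> 'a list \<Rightarrow> 'a list" where
  "level_step m v = (\<lambda>(J, y) R.
     if m < length R \<or> (\<exists>z\<in>set R. agree J (v y) (v z)) then R else y # R)"

text \<open>The trees are in continuation-passing style, so that phases can be chained;
  \<open>k\<close> receives the first index at which the two samples differ.\<close>

primrec diff_tree :: "nat \<Rightarrow> nat \<Rightarrow> nat list \<Rightarrow> dtree \<Rightarrow> (nat \<Rightarrow> dtree) \<Rightarrow> dtree" where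
  "diff_tree y z [] t k = t"
| "diff_tree y z (i # J) t k =
     Query y i (Query z i (diff_tree y z J t k) (k i)) (Query z i (k i) (diff_tree y z J t k))"

primrec scan_tree :: "nat \<Rightarrow> nat list \<Rightarrow> nat list \<Rightarrow> dtree \<Rightarrow> (nat \<Rightarrow> dtree) \<Rightarrow> dtree" where
  "scan_tree y J [] t k = t"
| "scan_tree y J (z # R) t k = diff_tree y z J (k z) (\<lambda>_. scan_tree y J R t k)"

primrec level_tree :: "nat \<Rightarrow> (nat list \<times> nat) list \<Rightarrow> nat list \<Rightarrow> dtree" where
  "level_tree m [] R = Answer (length R \<le> m)"
| "level_tree m (p # ps) R =
     (if m < length R then level_tree m ps R
      else scan_tree (snd p) (fst p) R (level_tree m ps (snd p # R)) (\<lambda>_. level_tree m ps R))"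

primrec probe_tree ::
    "nat \<Rightarrow> (nat list \<times> nat) list \<Rightarrow> nat list \<Rightarrow> nat list \<Rightarrow> (nat list \<Rightarrow> dtree) \<Rightarrow> dtree" where
  "probe_tree m [] R D k = k R"
| "probe_tree m (p # ps) R D k =
     (if m < length R then probe_tree m ps R D k
      else scan_tree (snd p) D R (probe_tree m ps (snd p # R) D k)
        (\<lambda>z. diff_tree (snd p) z (fst p) (probe_tree m ps R D k)
           (\<lambda>i. probe_tree m ps (snd p # R) (i # D) k)))"

lemma run_diff_tree:
  "run (diff_tree y z J t k) x =
     (case find (\<lambda>i. x y ! i \<noteq> x z ! i) J of None \<Rightarrow> run t x | Some i \<Rightarrow> run (k i) x)"
  by (induction J) auto

lemma queried_diff_tree:
  "queried (diff_tree y z J t k) x \<subseteq> {y, z} \<times> set J \<union>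
     (case find (\<lambda>i. x y ! i \<noteq> x z ! i) J of None \<Rightarrow> queried t x | Some i \<Rightarrow> queried (k i) x)"
  by (induction J) (auto split: option.splits)

lemma queries_within_diff_tree:
  assumes "y < s" "z < s" "\<forall>i\<in>set J. i < n" "queries_within s n t"
    "\<And>i. i \<in> set J \<Longrightarrow> queries_within s n (k i)"
  shows "queries_within s n (diff_tree y z J t k)"
  using assms by (induction J) auto

lemma find_diff_None: "find (\<lambda>i. u ! i \<noteq> w ! i) J = None \<longleftrightarrow> agree J u w"
  by (auto simp: find_None_iff agree_def)

lemma run_scan_tree:
  "run (scan_tree y J R t k) x =
     (case find (\<lambda>z. agree J (x y) (x z)) R of None \<Rightarrow> run t x | Some z \<Rightarrow> run (k z) x)"
proof (induction R)
  case (Cons z R)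
  show ?case
  proof (cases "agree J (x y) (x z)")
    case True
    then have "find (\<lambda>i. x y ! i \<noteq> x z ! i) J = None" by (simp only: find_diff_None)
    then show ?thesis using True by (simp add: run_diff_tree)
  next
    case False
    then have "find (\<lambda>i. x y ! i \<noteq> x z ! i) J \<noteq> None" by (simp only: find_diff_None not_False_eq_True)
    then show ?thesis using False Cons by (auto simp: run_diff_tree)
  qed
qed simp

lemma queried_scan_tree:
  "queried (scan_tree y J R t k) x \<subseteq> insert y (set R) \<times> set J \<union>
     (case find (\<lambda>z. agree J (x y) (x z)) R of None \<Rightarrow> queried t x | Some z \<Rightarrow> queried (k z) x)"
proof (induction R)
  case (Cons z R)
  show ?case
  proof (cases "agree J (x y) (x z)")
    case True
    then show ?thesis
      using queried_diff_tree[of y z J "k z" _ x] find_diff_None[of "x y" "x z" J] by fastforce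
  next
    case False
    then obtain i where "find (\<lambda>i. x y ! i \<noteq> x z ! i) J = Some i"
      using find_diff_None[of "x y" "x z" J] by (cases "find (\<lambda>i. x y ! i \<noteq> x z ! i) J") auto
    then have "queried (scan_tree y J (z # R) t k) x \<subseteq> {y, z} \<times> set J \<union> queried (scan_tree y J R t k) x"
      using queried_diff_tree[of y z J "k z" "\<lambda>_. scan_tree y J R t k" x] by simp
    then show ?thesis using Cons False by (simp split: option.splits) blast+
  qed
qed simp

lemma queries_within_scan_tree:
  assumes "y < s" "\<forall>z\<in>set R. z < s" "\<forall>i\<in>set J. i < n" "queries_within s n t"
    "\<And>z. z \<in> set R \<Longrightarrow> queries_within s n (k z)"
  shows "queries_within s n (scan_tree y J R t k)"
  using assms by (induction R) (auto intro!: queries_within_diff_tree)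

lemma run_level_tree:
  "run (level_tree m ps R) x \<longleftrightarrow> length (fold (level_step m x) ps R) \<le> m"
proof (induction ps arbitrary: R)
  case (Cons p ps)
  show ?case
  proof (cases "find (\<lambda>z. agree (fst p) (x (snd p)) (x z)) R")
    case None
    then have "\<not> (\<exists>z\<in>set R. agree (fst p) (x (snd p)) (x z))" by (simp add: find_None_iff)
    then show ?thesis using None Cons by (cases p) (simp add: run_scan_tree level_step_def)
  next
    case (Some z)
    then have "\<exists>z\<in>set R. agree (fst p) (x (snd p)) (x z)" by (blast dest: find_SomeD)
    then show ?thesis using Some Cons by (cases p) (simp add: run_scan_tree level_step_def)
  qed
qed simp

lemma queries_within_level_tree:
  assumes "\<forall>p\<in>set ps. snd p < s \<and> (\<forall>i\<in>set (fst p). i < n)" "\<forall>z\<in>set R. z < s"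
  shows "queries_within s n (level_tree m ps R)"
  using assms by (induction ps arbitrary: R) (auto intro!: queries_within_scan_tree)

lemma run_probe_tree:
  "run (probe_tree m ps R D k) x = run (k (fst (fold (probe_step m x) ps (R, D)))) x"
proof (induction ps arbitrary: R D)
  case (Cons p ps)
  then show ?case
    by (cases p) (simp add: run_scan_tree run_diff_tree probe_step_def split: option.split)
qed simp

lemma queries_within_probe_tree:
  assumes "\<forall>p\<in>set ps. snd p < s \<and> (\<forall>i\<in>set (fst p). i < n)"
    "\<forall>z\<in>set R. z < s" "\<forall>i\<in>set D. i < n"
    "\<And>R. \<forall>z\<in>set R. z < s \<Longrightarrow> queries_within s n (k R)"
  shows "queries_within s n (probe_tree m ps R D k)"
  using assms
  by (induction ps arbitrary: R D)
    (auto intro!: queries_within_scan_tree queries_within_diff_tree)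

section \<open>Counting distinct queries\<close>

lemma set_level_step_mono: "set R \<subseteq> set (level_step m v p R)"
  by (auto simp: level_step_def split: prod.split)

lemma set_fold_level_step_mono: "set R \<subseteq> set (fold (level_step m v) ps R)"
proof (induction ps arbitrary: R)
  case (Cons p ps)
  then show ?case using set_level_step_mono[of R m v p] by (simp del: Un_subset_iff) (meson order_trans)
qed simp

lemma length_level_step: "length (level_step m v p R) \<le> max (Suc m) (length R)"
  by (auto simp: level_step_def split: prod.split)

lemma length_fold_level_step: "length (fold (level_step m v) ps R) \<le> max (Suc m) (length R)"
proof (induction ps arbitrary: R)
  case (Cons p ps)
  from Cons[of "level_step m v p R"] length_level_step[of m v p R] show ?case by simp
qed simp

lemma probe_step_mono:
  assumes "probe_step m v p (R, D) = (R', D')"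
  shows "set R \<subseteq> set R'" "set D \<subseteq> set D'"
    "length R \<le> length R'" "length R' \<le> max (Suc m) (length R)"
    "length D' \<le> length D + (length R' - length R)" "length D' \<le> Suc (length D)"
  using assms by (auto simp: probe_step_def split: prod.splits option.splits if_splits)

lemma fold_probe_step_mono:
  assumes "fold (probe_step m v) ps (R, D) = (R', D')"
  shows "set R \<subseteq> set R' \<and> set D \<subseteq> set D' \<and>
    length R \<le> length R' \<and> length R' \<le> max (Suc m) (length R) \<and>
    length D' \<le> length D + (length R' - length R) \<and> length D' \<le> length ps + length D"
  using assms
proof (induction ps arbitrary: R D)
  case (Cons p ps)
  obtain R1 D1 where 1: "probe_step m v p (R, D) = (R1, D1)" by fastforce
  from Cons.IH[of R1 D1] Cons.prems 1 probe_step_mono[OF 1] show ?case by auto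
qed auto

text \<open>Reads are charged to two accounts. The newcomer's own reads go to \<open>Q\<close>; all
  reads of representatives, from whatever comparison, fall into the product of the final
  representatives with \<open>A\<close>. The second account does not grow with the number of
  samples.\<close>

lemma queried_level_tree:
  assumes "\<forall>p\<in>set ps. set (fst p) \<subseteq> A"
  shows "\<exists>Q. finite Q \<and> card Q \<le> (\<Sum>p\<leftarrow>ps. length (fst p)) \<and>
    queried (level_tree m ps R) x \<subseteq> Q \<union> set (fold (level_step m x) ps R) \<times> A"
  using assms
proof (induction ps arbitrary: R)
  case Nil
  then show ?case by (intro exI[of _ "{}"]) auto
next
  case (Cons p ps)
  obtain J y where p: "p = (J, y)" by fastforce
  define R1 where "R1 = level_step m x p R"
  obtain Q where Q: "finite Q" "card Q \<le> (\<Sum>p\<leftarrow>ps. length (fst p))"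
    "queried (level_tree m ps R1) x \<subseteq> Q \<union> set (fold (level_step m x) ps R1) \<times> A"
    using Cons.IH[of R1] Cons.prems by auto
  have R: "set R \<subseteq> set (fold (level_step m x) ps R1)"
    unfolding R1_def using set_level_step_mono set_fold_level_step_mono by (meson order_trans)
  have "queried (level_tree m (p # ps) R) x \<subseteq>
      {y} \<times> set J \<union> set R \<times> set J \<union> queried (level_tree m ps R1) x"
  proof (cases "m < length R")
    case False
    then have "queried (level_tree m (p # ps) R) x \<subseteq> insert y (set R) \<times> set J \<union>
       (case find (\<lambda>z. agree J (x y) (x z)) R of None \<Rightarrow> queried (level_tree m ps (y # R)) x
          | Some z \<Rightarrow> queried (level_tree m ps R) x)"
      using queried_scan_tree[of y J R "level_tree m ps (y # R)" "\<lambda>_. level_tree m ps R" x]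
      by (simp add: p)
    also have "\<dots> \<subseteq> {y} \<times> set J \<union> set R \<times> set J \<union> queried (level_tree m ps R1) x"
      using False by (auto simp: R1_def level_step_def p find_None_iff split: option.splits
        dest: find_SomeD)
    finally show ?thesis .
  qed (auto simp: R1_def level_step_def p)
  also have "\<dots> \<subseteq> ({y} \<times> set J \<union> Q) \<union> set (fold (level_step m x) (p # ps) R) \<times> A"
    using Q R Cons.prems by (auto simp: p R1_def)
  finally have "queried (level_tree m (p # ps) R) x \<subseteq> \<dots>" .
  moreover have "card ({y} \<times> set J \<union> Q) \<le> (\<Sum>p\<leftarrow>p # ps. length (fst p))"
    using card_Un_le[of "{y} \<times> set J" Q] Q(2) card_length[of J] by (simp add: p)
  ultimately show ?case using Q(1) by (intro exI[of _ "{y} \<times> set J \<union> Q"]) auto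
qed

text \<open>A probed sample is charged for itself on \<open>D\<close>, and for itself and its single
  candidate on the fresh indices, whence the factor 2. Reads of representatives on any intermediate
  \<open>D\<close> lie in the final product, as both factors only grow.\<close>

lemma queried_probe_tree:
  assumes "fold (probe_step m x) ps (R, D) = (R', D')"
  shows "\<exists>Q. finite Q \<and> card Q \<le> (\<Sum>p\<leftarrow>ps. card (set D') + 2 * length (fst p)) \<and>
    queried (probe_tree m ps R D k) x \<subseteq> Q \<union> set R' \<times> set D' \<union> queried (k R') x"
  using assms
proof (induction ps arbitrary: R D)
  case Nil
  then show ?case by (intro exI[of _ "{}"]) auto
next
  case (Cons p ps)
  obtain S y where p: "p = (S, y)" by fastforce
  obtain R1 D1 where 1: "probe_step m x p (R, D) = (R1, D1)" by fastforce
  with Cons.prems have f: "fold (probe_step m x) ps (R1, D1) = (R', D')" by simp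
  obtain Q where Q: "finite Q" "card Q \<le> (\<Sum>p\<leftarrow>ps. card (set D') + 2 * length (fst p))"
    "queried (probe_tree m ps R1 D1 k) x \<subseteq> Q \<union> set R' \<times> set D' \<union> queried (k R') x"
    using Cons.IH[OF f] by blast
  have sub: "set R \<subseteq> set R'" "set D \<subseteq> set D'"
    using fold_probe_step_mono[OF Cons.prems] by auto
  have "\<exists>z. queried (probe_tree m (p # ps) R D k) x \<subseteq>
      insert y (set R) \<times> set D \<union> {y, z} \<times> set S \<union> queried (probe_tree m ps R1 D1 k) x"
  proof (cases "m < length R")
    case True
    then show ?thesis using 1 by (auto simp: probe_step_def p)
  next
    case False
    let ?k = "\<lambda>z. diff_tree y z S (probe_tree m ps R D k) (\<lambda>i. probe_tree m ps (y # R) (i # D) k)"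
    have a: "queried (probe_tree m (p # ps) R D k) x \<subseteq> insert y (set R) \<times> set D \<union>
       (case find (\<lambda>z. agree D (x y) (x z)) R of None \<Rightarrow> queried (probe_tree m ps (y # R) D k) x
          | Some z \<Rightarrow> queried (?k z) x)"
      using queried_scan_tree[of y D R "probe_tree m ps (y # R) D k" ?k x] False by (simp add: p)
    show ?thesis
    proof (cases "find (\<lambda>z. agree D (x y) (x z)) R")
      case None
      then have "(R1, D1) = (y # R, D)" using 1 False by (simp add: probe_step_def p)
      then show ?thesis using a None by (intro exI[of _ y]) (auto simp del: probe_tree.simps)
    next
      case (Some z)
      have "queried (?k z) x \<subseteq> {y, z} \<times> set S \<union> queried (probe_tree m ps R1 D1 k) x"
        using queried_diff_tree[of y z S "probe_tree m ps R D k" "\<lambda>i. probe_tree m ps (y # R) (i # D) k" x]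
          1 False Some
        by (auto simp: probe_step_def p split: option.splits)
      then show ?thesis using a Some by (intro exI[of _ z]) auto
    qed
  qed
  then obtain z where z: "queried (probe_tree m (p # ps) R D k) x \<subseteq>
      insert y (set R) \<times> set D \<union> {y, z} \<times> set S \<union> queried (probe_tree m ps R1 D1 k) x" by blast
  define Q' where "Q' = {y} \<times> set D' \<union> {y} \<times> set S \<union> {z} \<times> set S \<union> Q"
  have "queried (probe_tree m (p # ps) R D k) x \<subseteq> Q' \<union> set R' \<times> set D' \<union> queried (k R') x"
    using z Q(3) sub unfolding Q'_def by blast
  moreover have "card Q' \<le> card ({y} \<times> set D') + card ({y} \<times> set S) + card ({z} \<times> set S) + card Q"
    unfolding Q'_def by (meson add_mono_thms_linordered_semiring(3) card_Un_le order_trans)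
  then have "card Q' \<le> (\<Sum>p\<leftarrow>p # ps. card (set D') + 2 * length (fst p))"
    using Q(2) card_length[of S] by (simp add: p)
  moreover have "finite Q'" using Q(1) by (simp add: Q'_def)
  ultimately show ?case by blast
qed

lemma card_queried_probe_level_tree:
  assumes "\<forall>p\<in>set qs. set (fst p) \<subseteq> A" "finite A"
  shows "card (queried (probe_tree m ps [] [] (level_tree m qs)) x) \<le>
    (\<Sum>p\<leftarrow>ps. Suc m + 2 * length (fst p)) + Suc m * length ps
     + (\<Sum>p\<leftarrow>qs. length (fst p)) + Suc m * card A"
proof -
  obtain R D where f: "fold (probe_step m x) ps ([], []) = (R, D)" by fastforce
  from fold_probe_step_mono[OF f] have len: "length R \<le> Suc m" "length D \<le> length R" "length D \<le> length ps"
    by auto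
  define R' where "R' = fold (level_step m x) qs R"
  have len': "length R' \<le> Suc m" using length_fold_level_step[of m x qs R] len by (simp add: R'_def)
  obtain Q1 where Q1: "finite Q1" "card Q1 \<le> (\<Sum>p\<leftarrow>ps. card (set D) + 2 * length (fst p))"
    "queried (probe_tree m ps [] [] (level_tree m qs)) x \<subseteq> Q1 \<union> set R \<times> set D \<union> queried (level_tree m qs R) x"
    using queried_probe_tree[OF f] by blast
  obtain Q2 where Q2: "finite Q2" "card Q2 \<le> (\<Sum>p\<leftarrow>qs. length (fst p))"
    "queried (level_tree m qs R) x \<subseteq> Q2 \<union> set R' \<times> A"
    using queried_level_tree[OF assms(1)] unfolding R'_def by blast
  \<comment> \<open>Both bounds are used: \<open>Suc m\<close> for the matching cost of each probed
    sample, and \<open>length ps\<close> to keep the product with the representatives linear in the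
    number of probes.\<close>
  have D: "card (set D) \<le> Suc m" "card (set D) \<le> length ps"
    using len card_length[of D] by linarith+
  have R: "card (set R) \<le> Suc m" "card (set R') \<le> Suc m"
    using len len' card_length[of R] card_length[of R'] by linarith+
  have "card (queried (probe_tree m ps [] [] (level_tree m qs)) x) \<le>
      card (Q1 \<union> set R \<times> set D \<union> Q2 \<union> set R' \<times> A)"
    using Q1 Q2 assms(2) by (intro card_mono) auto
  also have "\<dots> \<le> card Q1 + card (set R \<times> set D) + card Q2 + card (set R' \<times> A)"
    by (meson add_mono_thms_linordered_semiring(3) card_Un_le order_trans)
  also have "card (set R \<times> set D) \<le> Suc m * length ps"
    using D R by (simp add: card_cartesian_product mult_le_mono del: mult_Suc)
  also have "card (set R' \<times> A) \<le> Suc m * card A"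
    using R by (simp add: card_cartesian_product mult_le_mono del: mult_Suc)
  also have "card Q1 \<le> (\<Sum>p\<leftarrow>ps. Suc m + 2 * length (fst p))"
    using D(1) by (intro order_trans[OF Q1(2)] sum_list_mono) auto
  finally show ?thesis using Q2(2) by linarith
qed

section \<open>Representatives and the comparison with the idealised selection\<close>

lemma find_map: "find P (map f xs) = map_option f (find (P \<circ> f) xs)"
  by (induction xs) auto

text \<open>The selection inspects only values, so it commutes with replacing sample numbers by
  their values. This carries runs of the trees over to lists of strings drawn from
  \<open>P\<close>.\<close>

lemma probe_step_map:
  "apfst (map v) (probe_step m v p s) = probe_step m id (apsnd v p) (apfst (map v) s)"
  by (auto simp: probe_step_def find_map comp_def split: prod.split option.split)

lemma fold_probe_step_map:
  "apfst (map v) (fold (probe_step m v) ps s) =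
     fold (probe_step m id) (map (apsnd v) ps) (apfst (map v) s)"
  by (induction ps arbitrary: s) (simp_all add: probe_step_map)

lemma level_step_map:
  "map v (level_step m v p R) = level_step m id (apsnd v p) (map v R)"
  by (auto simp: level_step_def split: prod.split)

lemma fold_level_step_map:
  "map v (fold (level_step m v) ps R) = fold (level_step m id) (map (apsnd v) ps) (map v R)"
  by (induction ps arbitrary: R) (simp_all add: level_step_map)

lemma agree_sym: "agree J u w \<longleftrightarrow> agree J w u"
  by (auto simp: agree_def)

lemma agree_trans: "agree J u v \<Longrightarrow> agree J v w \<Longrightarrow> agree J u w"
  by (simp add: agree_def)

lemma agree_refl [simp]: "agree J u u"
  by (simp add: agree_def)

lemma agree_mono: "agree J u w \<Longrightarrow> set J' \<subseteq> set J \<Longrightarrow> agree J' u w"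
  by (auto simp: agree_def)

text \<open>This is the invariant of probing: it makes the candidate unique and certifies that the
  representatives are distinct.\<close>

definition told_apart :: "nat list \<Rightarrow> bool list list \<Rightarrow> bool" where
  "told_apart D R \<longleftrightarrow> distinct R \<and> (\<forall>u\<in>set R. \<forall>w\<in>set R. u \<noteq> w \<longrightarrow> \<not> agree D u w)"

lemma told_apart_mono: "told_apart D R \<Longrightarrow> told_apart (i # D) R"
  by (auto simp: told_apart_def agree_def)

lemma told_apart_Cons:
  "told_apart D R \<Longrightarrow> (\<And>w. w \<in> set R \<Longrightarrow> \<not> agree D y w) \<Longrightarrow> told_apart D (y # R)"
  unfolding told_apart_def by (metis agree_refl agree_sym distinct.simps(2) set_ConsD)

text \<open>One new index is enough: if \<open>y\<close> agrees with \<open>z\<close> on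
  \<open>D\<close>, then it already differs there from every other representative, because
  \<open>z\<close> does. An index separating \<open>y\<close> from \<open>z\<close> therefore
  separates it from all.\<close>

lemma told_apart_probe_step:
  assumes "told_apart D R" "probe_step m id (S, y) (R, D) = (R', D')"
  shows "told_apart D' R'"
proof (cases "m < length R")
  case True
  with assms show ?thesis by (simp add: probe_step_def)
next
  case False
  show ?thesis
  proof (cases "find (agree D y) R")
    case None
    have eq: "R' = y # R" "D' = D" using assms(2) False None by (auto simp: probe_step_def)
    show ?thesis
      unfolding eq using None by (intro told_apart_Cons assms) (auto simp: find_None_iff)
  next
    case (Some z)
    then have z: "z \<in> set R" "agree D y z" by (auto dest: find_SomeD)
    show ?thesis
    proof (cases "find (\<lambda>i. y ! i \<noteq> z ! i) S")
      case None
      with Some False assms show ?thesis by (simp add: probe_step_def)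
    next
      case i: (Some i)
      have eq: "R' = y # R" "D' = i # D" using assms(2) False Some i by (auto simp: probe_step_def)
      have "\<not> agree (i # D) y w" if "w \<in> set R" for w
      proof
        assume a: "agree (i # D) y w"
        then have "agree D z w" using z(2) by (auto simp: agree_def)
        then have "w = z" using assms(1) z(1) that by (auto simp: told_apart_def)
        with a i show False by (auto simp: agree_def dest: find_SomeD)
      qed
      then show ?thesis unfolding eq by (intro told_apart_Cons told_apart_mono assms)
    qed
  qed
qed

lemma distinct_fold_probe_step:
  assumes "told_apart D R"
  shows "distinct (fst (fold (probe_step m id) ps (R, D)))"
  using assms
proof (induction ps arbitrary: R D)
  case Nil
  then show ?case by (simp add: told_apart_def)
next
  case (Cons p ps)
  obtain S y where p: "p = (S, y)" by fastforce
  obtain R1 D1 where 1: "probe_step m id (S, y) (R, D) = (R1, D1)" by fastforce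
  from Cons.IH[OF told_apart_probe_step[OF Cons.prems 1]] show ?case by (simp only: p fold_simps 1)
qed

lemma distinct_fold_level_step:
  assumes "distinct R"
  shows "distinct (fold (level_step m id) ps R)"
  using assms
proof (induction ps arbitrary: R)
  case (Cons p ps)
  then have "distinct (level_step m id p R)"
    by (auto simp: level_step_def split: prod.split)
  with Cons.IH show ?case by (simp only: fold_simps)
qed simp

lemma set_fold_probe_step_subset:
  "set (fst (fold (probe_step m v) ps s)) \<subseteq> set (fst s) \<union> snd ` set ps"
proof (induction ps arbitrary: s)
  case (Cons p ps)
  have "set (fst (probe_step m v p s)) \<subseteq> insert (snd p) (set (fst s))"
    by (auto simp: probe_step_def split: prod.splits option.splits if_splits)
  with Cons.IH[of "probe_step m v p s"] show ?case by auto
qed simp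

lemma set_fold_level_step_subset:
  "set (fold (level_step m v) ps R) \<subseteq> set R \<union> snd ` set ps"
proof (induction ps arbitrary: R)
  case (Cons p ps)
  have "set (level_step m v p R) \<subseteq> insert (snd p) (set R)"
    by (auto simp: level_step_def split: prod.splits if_splits)
  with Cons.IH[of "level_step m v p R"] show ?case by auto
qed simp

lemma hamming_dist_self [simp]: "hamming_dist n u u = 0"
  by (simp add: hamming_dist_def)

lemma hamming_dist_nonneg [simp]: "0 \<le> hamming_dist n u w"
  by (simp add: hamming_dist_def)

lemma hamming_dist_le_1: "hamming_dist n u w \<le> 1"
proof -
  have "card {i. i < n \<and> u ! i \<noteq> w ! i} \<le> card {..<n}" by (intro card_mono) auto
  then show ?thesis by (cases "n = 0") (simp_all add: hamming_dist_def)
qed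

text \<open>
  The idealised selection compares true distances with the threshold of level \<open>j\<close>. It does not
  depend on the random index list, which is what makes a union bound over the at most
  \<open>m (m + 1)\<close> pairs in \<open>critical\<close> possible, instead of over all pairs of samples.
\<close>

definition ideal_accept :: "nat \<Rightarrow> nat \<Rightarrow> nat \<times> bool list \<Rightarrow> bool list list \<Rightarrow> bool" where
  "ideal_accept m n = (\<lambda>(j, y) Z.
     length Z \<le> m \<and> (\<forall>z\<in>set Z. 1 / 2 ^ Suc j < hamming_dist n y z))"

definition ideal_step :: "nat \<Rightarrow> nat \<Rightarrow> nat \<times> bool list \<Rightarrow> bool list list \<Rightarrow> bool list list" where
  "ideal_step m n p Z = (if ideal_accept m n p Z then snd p # Z else Z)"

primrec critical :: "nat \<Rightarrow> nat \<Rightarrow> (nat \<times> bool list) list \<Rightarrow> bool list list \<Rightarrow>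
    (nat \<times> bool list \<times> bool list) set" where
  "critical m n [] Z = {}"
| "critical m n (p # ps) Z =
     (if ideal_accept m n p Z then (\<lambda>z. (fst p, snd p, z)) ` set Z else {}) \<union>
     critical m n ps (ideal_step m n p Z)"

lemma finite_critical: "finite (critical m n ps Z)"
  by (induction ps arbitrary: Z) auto

text \<open>Pairs arise only at acceptances: at most \<open>Suc m - length Z\<close> of them remain,
  each with at most \<open>m\<close> partners. The number of samples does not enter, so the union
  bound needs only \<open>O(log m)\<close> in the exponent, without a dependence on
  \<epsilon>.\<close>

lemma card_critical: "card (critical m n ps Z) \<le> m * (Suc m - length Z)"
proof (induction ps arbitrary: Z)
  case (Cons p ps)
  show ?case
  proof (cases "ideal_accept m n p Z")
    case True
    then have len: "length Z \<le> m" by (auto simp: ideal_accept_def)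
    have "card (critical m n (p # ps) Z) \<le>
        card ((\<lambda>z. (fst p, snd p, z)) ` set Z) + card (critical m n ps (snd p # Z))"
      using True card_Un_le by (simp add: ideal_step_def)
    also have "card ((\<lambda>z. (fst p, snd p, z)) ` set Z) \<le> m"
      using card_image_le[of "set Z"] card_length[of Z] len by (meson List.finite_set order_trans)
    also have "card (critical m n ps (snd p # Z)) \<le> m * (m - length Z)"
      using Cons.IH[of "snd p # Z"] by simp
    also have "m + m * (m - length Z) = m * (Suc m - length Z)"
      using len by (simp add: Suc_diff_le)
    finally show ?thesis by simp
  next
    case False
    then show ?thesis using Cons.IH[of Z] by (simp add: ideal_step_def)
  qed
qed simp

lemma critical_hamming_dist:
  assumes "(j, y, z) \<in> critical m n ps Z"
  shows "1 / 2 ^ Suc j < hamming_dist n y z \<and> j \<in> fst ` set ps"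
  using assms
  by (induction ps arbitrary: Z)
    (auto simp: ideal_accept_def simp del: power_Suc split: if_splits prod.splits)

lemma distinct_fold_ideal_step:
  "distinct Z \<Longrightarrow> distinct (fold (ideal_step m n) ps Z)"
proof (induction ps arbitrary: Z)
  case (Cons p ps)
  have "snd p \<notin> set Z" if "ideal_accept m n p Z"
  proof
    assume "snd p \<in> set Z"
    with that have "1 / 2 ^ Suc (fst p) < hamming_dist n (snd p) (snd p)"
      unfolding ideal_accept_def case_prod_beta by blast
    then show False by (simp add: divide_less_0_iff)
  qed
  with Cons.prems have "distinct (ideal_step m n p Z)" by (simp add: ideal_step_def)
  with Cons.IH show ?case by simp
qed simp

lemma length_fold_level_step_mono: "length R \<le> length (fold (level_step m v) ps R)"
proof (induction ps arbitrary: R)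
  case (Cons p ps)
  have "length R \<le> length (level_step m v p R)" by (auto simp: level_step_def split: prod.split)
  with Cons[of "level_step m v p R"] show ?case by simp
qed simp

text \<open>
  The injection \<open>f\<close> sends an idealised representative to an actual one that agrees with it on the
  indices of the current level. Levels are processed from the finest to the coarsest, so index sets
  only shrink and this agreement is never lost.
\<close>

lemma card_ideal_le_length_level:
  assumes "sorted_wrt (\<ge>) (map fst ps)" "\<forall>p\<in>set ps. fst p \<le> l"
    and J: "\<And>i j. i \<le> j \<Longrightarrow> set (J i) \<subseteq> set (J j)"
    and "\<And>j y z. (j, y, z) \<in> critical m n ps Z \<Longrightarrow> \<not> agree (J j) y z"
    and "inj_on f (set Z)" "f ` set Z \<subseteq> set R" "\<And>z. z \<in> set Z \<Longrightarrow> agree (J l) z (f z)"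
    and "length (fold (level_step m id) (map (apfst J) ps) R) \<le> m"
  shows "card (set (fold (ideal_step m n) ps Z)) \<le>
    length (fold (level_step m id) (map (apfst J) ps) R)"
  using assms(1,2,4-)
proof (induction ps arbitrary: R Z f l)
  case Nil
  have "card (set Z) = card (f ` set Z)" using Nil.prems by (simp add: card_image)
  also have "\<dots> \<le> card (set R)" using Nil.prems by (intro card_mono) auto
  also have "\<dots> \<le> length R" by (rule card_length)
  finally show ?case by simp
next
  case (Cons p ps)
  obtain j y where p: "p = (j, y)" by fastforce
  have "j \<le> l" using Cons.prems by (simp add: p)
  have agr: "agree (J j) z (f z)" if "z \<in> set Z" for z
    using Cons.prems(6)[OF that] J[OF \<open>j \<le> l\<close>] by (rule agree_mono)
  define R1 where "R1 = level_step m id (J j, y) R"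
  define Z1 where "Z1 = ideal_step m n p Z"
  have fin: "length (fold (level_step m id) (map (apfst J) ps) R1) \<le> m"
    using Cons.prems(7) by (simp only: p R1_def list.map fold_simps apfst_conv)
  \<comment> \<open>The final length is at most \<open>m\<close>, so the actual selection never
    freezes and every unmatched sample is added.\<close>
  have lenR: "length R \<le> m"
    using Cons.prems(7) by (rule order_trans[OF length_fold_level_step_mono])
  have sub: "set R \<subseteq> set R1" by (auto simp: R1_def level_step_def)
  \<comment> \<open>The witness \<open>w\<close> is an old representative that absorbs
    \<open>y\<close>, or else \<open>y\<close> itself; it becomes the image of \<open>y\<close>
    under the extended injection.\<close>
  have "\<exists>w\<in>set R1. agree (J j) y w \<and> (w \<in> set R \<or> w = y \<and> (\<forall>z\<in>set R. \<not> agree (J j) y z))"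
  proof (cases "\<exists>z\<in>set R. agree (J j) y z")
    case False
    then have "y \<in> set R1" using lenR by (auto simp: R1_def level_step_def)
    with False show ?thesis by (intro bexI[of _ y]) auto
  qed (use sub in blast)
  then obtain w where w: "w \<in> set R1" "agree (J j) y w"
    "w \<in> set R \<or> w = y \<and> (\<forall>z\<in>set R. \<not> agree (J j) y z)" by blast
  have "\<exists>g. inj_on g (set Z1) \<and> g ` set Z1 \<subseteq> set R1 \<and> (\<forall>z\<in>set Z1. agree (J j) z (g z))"
  proof (cases "ideal_accept m n p Z")
    case False
    then show ?thesis using Cons.prems agr sub
      by (intro exI[of _ f]) (auto simp: Z1_def ideal_step_def)
  next
    case True
    then have Z1: "Z1 = y # Z" by (simp add: Z1_def ideal_step_def p)
    have sep: "\<not> agree (J j) y z" if "z \<in> set Z" for z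
      using Cons.prems(3)[of j y z] True that by (auto simp: p)
    then have y: "y \<notin> set Z" using agree_refl by blast
    \<comment> \<open>If \<open>w\<close> were already the image of some \<open>z\<close>, then
      \<open>y\<close> and \<open>z\<close> would both agree with it on \<open>J j\<close>, hence
      with each other, although \<open>(j, y, z)\<close> is critical.\<close>
    have w': "w \<notin> f ` set Z"
    proof
      assume "w \<in> f ` set Z"
      then obtain z where z: "z \<in> set Z" "w = f z" by blast
      then have "agree (J j) y z" using w(2) agr[of z] by (meson agree_sym agree_trans)
      with sep z show False by blast
    qed
    have "(f(y := w)) ` (set Z - {y}) = f ` set Z" using y by (intro image_cong) auto
    moreover have "inj_on (f(y := w)) (set Z)" using Cons.prems(4) w' by (rule inj_on_fun_updI)
    ultimately have "inj_on (f(y := w)) (set Z1)"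
      using w' by (simp only: Z1 list.set inj_on_insert) simp
    moreover have "(f(y := w)) ` set Z1 \<subseteq> set R1" using Cons.prems(5) sub w(1) y by (auto simp: Z1)
    moreover have "\<forall>z\<in>set Z1. agree (J j) z ((f(y := w)) z)" using agr w(2) by (simp add: Z1)
    ultimately show ?thesis by blast
  qed
  then obtain g where g: "inj_on g (set Z1)" "g ` set Z1 \<subseteq> set R1" "\<And>z. z \<in> set Z1 \<Longrightarrow> agree (J j) z (g z)"
    by blast
  have "card (set (fold (ideal_step m n) ps Z1)) \<le> length (fold (level_step m id) (map (apfst J) ps) R1)"
  proof (rule Cons.IH[OF _ _ _ g fin])
    show "\<not> agree (J j) y z" if "(j, y, z) \<in> critical m n ps Z1" for j y z
      using Cons.prems(3)[of j y z] that by (simp add: Z1_def)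
  qed (use Cons.prems in \<open>auto simp: p\<close>)
  then show ?case by (simp only: p R1_def Z1_def list.map fold_simps apfst_conv)
qed

text \<open>Both selections start from the same list, so the injection starts as the identity;
  distinctness turns the cardinality of the idealised result into its length.\<close>

corollary length_level_gt:
  assumes "sorted_wrt (\<ge>) (map fst ps)" "distinct Z" "m < length (fold (ideal_step m n) ps Z)"
    and "\<And>i j. i \<le> j \<Longrightarrow> set (J i) \<subseteq> set (J j)"
    and "\<And>j y z. (j, y, z) \<in> critical m n ps Z \<Longrightarrow> \<not> agree (J j) y z"
  shows "m < length (fold (level_step m id) (map (apfst J) ps) Z)"
proof (rule ccontr)
  assume "\<not> ?thesis"
  then have "card (set (fold (ideal_step m n) ps Z)) \<le> m"
    using card_ideal_le_length_level[OF assms(1) _ assms(4,5), where l = "Max (fst ` set ps)" and f = id and R = Z]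
    by fastforce
  moreover have "card (set (fold (ideal_step m n) ps Z)) = length (fold (ideal_step m n) ps Z)"
    using distinct_fold_ideal_step[OF assms(2)] by (rule distinct_card)
  ultimately show False using assms(3) by simp
qed

section \<open>Random index lists\<close>

lemma map_take_replicate_pmf:
  assumes "k \<le> N"
  shows "map_pmf (take k) (replicate_pmf N p) = replicate_pmf k p"
proof -
  have "map_pmf (take k) (replicate_pmf N p) =
      replicate_pmf k p \<bind> (\<lambda>xs. map_pmf (\<lambda>ys. take k (xs @ ys)) (replicate_pmf (N - k) p))"
    using replicate_pmf_distrib[of k "N - k" p] assms
    by (simp add: map_bind_pmf map_pmf_def[symmetric] pmf.map_comp comp_def)
  also have "\<dots> = replicate_pmf k p \<bind> return_pmf"
  proof (intro bind_pmf_cong refl)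
    fix xs assume "xs \<in> set_pmf (replicate_pmf k p)"
    then have "length xs = k" by (simp add: set_replicate_pmf)
    then show "map_pmf (\<lambda>ys. take k (xs @ ys)) (replicate_pmf (N - k) p) = return_pmf xs"
      by simp
  qed
  finally show ?thesis by (simp add: bind_return_pmf')
qed

lemma prob_replicate_pmf_subset:
  fixes p :: "'a::countable pmf"
  shows "measure_pmf.prob (replicate_pmf k p) {xs. set xs \<subseteq> A} = measure_pmf.prob p A ^ k"
proof (induction k)
  case (Suc k)
  have "replicate_pmf (Suc k) p = map_pmf (\<lambda>(x, xs). x # xs) (pair_pmf p (replicate_pmf k p))"
    by (simp add: pair_pmf_def map_bind_pmf map_pmf_def bind_assoc_pmf bind_return_pmf)
  then have "measure_pmf.prob (replicate_pmf (Suc k) p) {xs. set xs \<subseteq> A} =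
      measure_pmf.prob (pair_pmf p (replicate_pmf k p)) (A \<times> {xs. set xs \<subseteq> A})"
    by (simp add: measure_map_pmf vimage_def) (rule arg_cong[where f = "measure _"], auto)
  also have "\<dots> = measure_pmf.prob p A * measure_pmf.prob (replicate_pmf k p) {xs. set xs \<subseteq> A}"
    by (rule measure_pmf_prob_product) auto
  finally show ?case using Suc by simp
qed simp

lemma prob_agree_indices:
  assumes "0 < n"
  shows "measure_pmf.prob (replicate_pmf k (pmf_of_set {..<n})) {I. agree I y z} = (1 - hamming_dist n y z) ^ k"
proof -
  have "{..<n} = ({..<n} \<inter> {i. y ! i = z ! i}) \<union> {i. i < n \<and> y ! i \<noteq> z ! i}" by auto
  then have "card {..<n} = card ({..<n} \<inter> {i. y ! i = z ! i}) + card {i. i < n \<and> y ! i \<noteq> z ! i}"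
    by (subst (1) \<open>{..<n} = _\<close>, subst card_Un_disjoint) auto
  then have "real (card ({..<n} \<inter> {i. y ! i = z ! i})) = real n - real (card {i. i < n \<and> y ! i \<noteq> z ! i})"
    by simp
  moreover have "measure_pmf.prob (pmf_of_set {..<n}) {i. y ! i = z ! i} =
      real (card ({..<n} \<inter> {i. y ! i = z ! i})) / real n"
    using assms by (subst measure_pmf_of_set) auto
  ultimately have "measure_pmf.prob (pmf_of_set {..<n}) {i. y ! i = z ! i} = 1 - hamming_dist n y z"
    using assms by (simp add: hamming_dist_def diff_divide_distrib)
  moreover have "{I. agree I y z} = {I. set I \<subseteq> {i. y ! i = z ! i}}" by (auto simp: agree_def)
  ultimately show ?thesis by (simp add: prob_replicate_pmf_subset)
qed

lemma prob_agree_take: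
  assumes "0 < n" "2 ^ Suc j * K \<le> N" "1 / 2 ^ Suc j < hamming_dist n y z"
  shows "measure_pmf.prob (replicate_pmf N (pmf_of_set {..<n})) {I. agree (take (2 ^ Suc j * K) I) y z}
    \<le> exp (- real K)"
proof -
  let ?k = "2 ^ Suc j * K" and ?\<delta> = "hamming_dist n y z"
  have "measure_pmf.prob (replicate_pmf N (pmf_of_set {..<n})) {I. agree (take ?k I) y z} =
      measure_pmf.prob (map_pmf (take ?k) (replicate_pmf N (pmf_of_set {..<n}))) {I. agree I y z}"
    by (simp add: measure_map_pmf vimage_def)
  also have "\<dots> = (1 - ?\<delta>) ^ ?k"
    using assms by (simp only: map_take_replicate_pmf prob_agree_indices)
  also have "\<dots> \<le> exp (- ?\<delta>) ^ ?k"
    using exp_ge_add_one_self[of "- ?\<delta>"] hamming_dist_le_1[of n y z] by (intro power_mono) auto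
  also have "\<dots> = exp (- (real ?k * ?\<delta>))" by (simp add: exp_of_nat_mult[symmetric] del: power_Suc)
  also have "real K \<le> real ?k * ?\<delta>"
  proof -
    have "1 \<le> 2 ^ Suc j * ?\<delta>" using assms(3) by (simp add: field_simps)
    then have "real K * 1 \<le> real K * (2 ^ Suc j * ?\<delta>)" by (intro mult_left_mono) auto
    then show ?thesis by (simp add: mult_ac)
  qed
  then have "exp (- (real ?k * ?\<delta>)) \<le> exp (- real K)" by simp
  finally show ?thesis .
qed

text \<open>The samples are fixed here and only \<open>I\<close> is random. The critical pairs do
  not depend on \<open>I\<close>, so a union bound over them is legitimate; each pair agrees on its
  prefix with probability at most \<open>exp (- real K)\<close>.\<close>

lemma prob_level_le:
  assumes "0 < n" "sorted_wrt (\<ge>) (map fst ps)" "\<forall>p\<in>set ps. fst p < L"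
    and "distinct Z" "m < length (fold (ideal_step m n) ps Z)"
  shows "measure_pmf.prob (replicate_pmf (2 ^ L * K) (pmf_of_set {..<n}))
      {I. length (fold (level_step m id) (map (apfst (\<lambda>j. take (2 ^ Suc j * K) I)) ps) Z) \<le> m}
    \<le> real (m * Suc m) * exp (- real K)"
proof -
  let ?M = "replicate_pmf (2 ^ L * K) (pmf_of_set {..<n})"
  let ?B = "\<lambda>(j, y, z). {I. agree (take (2 ^ Suc j * K) I) y z}"
  let ?C = "critical m n ps Z"
  have mono: "set (take (2 ^ Suc i * K) I) \<subseteq> set (take (2 ^ Suc j * K) I)" if "i \<le> j" for i j and I :: "nat list"
  proof (rule set_take_subset_set_take)
    show "2 ^ Suc i * K \<le> 2 ^ Suc j * K" using that by (intro mult_le_mono1 power_increasing) auto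
  qed
  have "{I. length (fold (level_step m id) (map (apfst (\<lambda>j. take (2 ^ Suc j * K) I)) ps) Z) \<le> m} \<subseteq> (\<Union>c\<in>?C. ?B c)"
  proof (intro subsetI, rule ccontr)
    fix I assume I: "I \<in> {I. length (fold (level_step m id) (map (apfst (\<lambda>j. take (2 ^ Suc j * K) I)) ps) Z) \<le> m}"
      "I \<notin> (\<Union>c\<in>?C. ?B c)"
    have "m < length (fold (level_step m id) (map (apfst (\<lambda>j. take (2 ^ Suc j * K) I)) ps) Z)"
      using assms(2,4,5) mono
    proof (rule length_level_gt)
      show "\<not> agree (take (2 ^ Suc j * K) I) y z" if "(j, y, z) \<in> ?C" for j y z
        using I(2) that by (auto simp del: power_Suc)
    qed
    with I(1) show False by (simp del: power_Suc)
  qed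
  then have "measure_pmf.prob ?M {I. length (fold (level_step m id) (map (apfst (\<lambda>j. take (2 ^ Suc j * K) I)) ps) Z) \<le> m}
      \<le> measure_pmf.prob ?M (\<Union>c\<in>?C. ?B c)"
    by (intro measure_pmf.finite_measure_mono) auto
  also have "\<dots> \<le> (\<Sum>c\<in>?C. measure_pmf.prob ?M (?B c))"
    by (intro measure_pmf.finite_measure_subadditive_finite finite_critical) auto
  also have "\<dots> \<le> (\<Sum>c\<in>?C. exp (- real K))"
  proof (intro sum_mono)
    fix c assume c: "c \<in> ?C"
    obtain j y z where [simp]: "c = (j, y, z)" by (metis surj_pair)
    from critical_hamming_dist[OF c[simplified]] have d: "1 / 2 ^ Suc j < hamming_dist n y z"
      and "j \<in> fst ` set ps" by auto
    with assms(3) have "j < L" by auto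
    then have "2 ^ Suc j * K \<le> 2 ^ L * K" by (intro mult_le_mono1 power_increasing) auto
    from prob_agree_take[OF assms(1) this d] show "measure_pmf.prob ?M (?B c) \<le> exp (- real K)"
      by simp
  qed
  also have "\<dots> = real (card ?C) * exp (- real K)" by simp
  also have "\<dots> \<le> real (m * Suc m) * exp (- real K)"
  proof -
    have "card ?C \<le> m * (Suc m - length Z)" by (rule card_critical)
    also have "\<dots> \<le> m * Suc m" by (intro mult_le_mono2) simp
    finally show ?thesis by (intro mult_right_mono) (simp_all only: of_nat_le_iff exp_ge_zero)
  qed
  finally show ?thesis .
qed

section \<open>Earth mover's distance and Markov chains\<close>

text \<open>The inserted 1 gives an empty list the largest possible distance, so the first sample
  counts as far from everything. For nonempty lists the minimum is unchanged, since Hamming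
  distances are at most 1.\<close>

definition gap :: "nat \<Rightarrow> bool list list \<Rightarrow> bool list \<Rightarrow> real" where
  "gap n R y = Min (insert 1 (hamming_dist n y ` set R))"

lemma gap_nonneg: "0 \<le> gap n R y"
  by (auto simp: gap_def)

lemma gap_le_1: "gap n R y \<le> 1"
  by (simp add: gap_def)

lemma gap_le_hamming_dist: "z \<in> set R \<Longrightarrow> gap n R y \<le> hamming_dist n y z"
  by (simp add: gap_def)

lemma gap_antimono: "set R \<subseteq> set R' \<Longrightarrow> gap n R' y \<le> gap n R y"
  unfolding gap_def by (intro Min_antimono) auto

lemma gap_attained:
  assumes "R \<noteq> []"
  shows "\<exists>z\<in>set R. gap n R y = hamming_dist n y z"
proof -
  have "gap n R y \<in> insert 1 (hamming_dist n y ` set R)" unfolding gap_def by (intro Min_in) auto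
  moreover have "\<exists>z\<in>set R. gap n R y = hamming_dist n y z" if "gap n R y = 1"
  proof -
    from assms have "hd R \<in> set R" by simp
    moreover from gap_le_hamming_dist[OF this, of n y] that hamming_dist_le_1[of n y "hd R"]
    have "gap n R y = hamming_dist n y (hd R)" by simp
    ultimately show ?thesis by blast
  qed
  ultimately show ?thesis by auto
qed

lemma finite_set_pmf_distributions:
  assumes "P \<in> distributions n"
  shows "finite (set_pmf P)"
proof (rule finite_subset)
  show "set_pmf P \<subseteq> {u. set u \<subseteq> UNIV \<and> length u = n}"
    using assms by (auto simp: distributions_def)
  show "finite {u :: bool list. set u \<subseteq> UNIV \<and> length u = n}" by (rule finite_lists_length_eq) simp
qed

lemma emd_nonneg: "0 \<le> emd n P Q"
  unfolding emd_def
proof (rule cINF_greatest)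
  have "pair_pmf P Q \<in> couplings P Q"
    by (simp add: couplings_def map_fst_pair_pmf map_snd_pair_pmf)
  then show "couplings P Q \<noteq> {}" by blast
qed (auto intro!: integral_nonneg_AE)

lemma emd_le_coupling:
  assumes "T \<in> couplings P Q"
  shows "emd n P Q \<le> measure_pmf.expectation T (\<lambda>(u, v). hamming_dist n u v)"
  unfolding emd_def
  by (rule cINF_lower[OF _ assms], rule bdd_belowI2[of _ 0]) (auto intro!: integral_nonneg_AE)

lemma far_from_imp_expectation_gap:
  assumes P: "P \<in> distributions n" and far: "far_from n \<epsilon> (supported_on_at_most n m) P"
    and R: "\<forall>z\<in>set R. length z = n" "length R \<le> m" and "\<epsilon> < 1"
  shows "\<epsilon> < measure_pmf.expectation P (gap n R)"
proof (cases "R = []")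
  \<comment> \<open>Without representatives there is nothing to move points to; the gap is
    constantly 1, and \<open>\<epsilon> < 1\<close> settles the case.\<close>
  case True
  then have "gap n R = (\<lambda>_. 1)" by (simp add: gap_def fun_eq_iff)
  then show ?thesis using \<open>\<epsilon> < 1\<close> by simp
next
  case False
  from gap_attained[OF this] obtain g where g: "\<And>y. g y \<in> set R" "\<And>y. gap n R y = hamming_dist n y (g y)"
    by metis
  define Q where "Q = map_pmf g P"
  define T where "T = map_pmf (\<lambda>y. (y, g y)) P"
  have "card (set_pmf Q) \<le> card (set R)" using g by (intro card_mono) (auto simp: Q_def)
  also have "\<dots> \<le> m" using R(2) card_length[of R] by linarith
  finally have Q: "Q \<in> supported_on_at_most n m"
    using g(1) R(1) by (auto simp: supported_on_at_most_def distributions_def Q_def)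
  have "\<epsilon> < (INF Q\<in>supported_on_at_most n m. emd n P Q)" using far by (simp add: far_from_def)
  also have "\<dots> \<le> emd n P Q"
    by (rule cINF_lower[OF _ Q], rule bdd_belowI2[of _ 0]) (rule emd_nonneg)
  also have "\<dots> \<le> measure_pmf.expectation T (\<lambda>(u, v). hamming_dist n u v)"
    by (intro emd_le_coupling) (simp add: couplings_def T_def Q_def pmf.map_comp comp_def)
  also have "\<dots> = measure_pmf.expectation P (gap n R)"
    by (simp add: T_def g(2)[abs_def])
  finally show ?thesis .
qed

section \<open>Markov chains with a list of kernels\<close>

primrec chain :: "('s \<Rightarrow> 's pmf) list \<Rightarrow> 's \<Rightarrow> 's pmf" where
  "chain [] s = return_pmf s"
| "chain (\<kappa> # ks) s = \<kappa> s \<bind> chain ks"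

lemma chain_append: "chain (ks @ ks') s = chain ks s \<bind> chain ks'"
proof (induction ks arbitrary: s)
  case (Cons \<kappa> ks)
  then have "chain (ks @ ks') = (\<lambda>s. chain ks s \<bind> chain ks')" by blast
  then show ?case by (simp add: bind_assoc_pmf)
qed (simp add: bind_return_pmf)

lemma chain_invariant:
  assumes "\<And>\<kappa> s s'. \<kappa> \<in> set ks \<Longrightarrow> I s \<Longrightarrow> s' \<in> set_pmf (\<kappa> s) \<Longrightarrow> I s'"
    and "I s" "s' \<in> set_pmf (chain ks s)"
  shows "I s'"
  using assms
proof (induction ks arbitrary: s)
  case (Cons \<kappa> ks)
  from Cons.prems(3) obtain s1 where "s1 \<in> set_pmf (\<kappa> s)" "s' \<in> set_pmf (chain ks s1)" by auto
  with Cons.prems Cons.IH[of s1] show ?case by (meson list.set_intros)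
qed simp

text \<open>
  Each \<open>v s\<close> bounds from below the expected growth of the counter in one step. Since \<open>v\<close> only
  decreases along the process, all these bounds may be evaluated at the final state.
\<close>

lemma chain_expected_counter:
  fixes N :: "'s \<Rightarrow> nat" and ks :: "(('s \<Rightarrow> 's pmf) \<times> ('s \<Rightarrow> ennreal)) list"
  assumes gain: "\<And>\<kappa> v s. (\<kappa>, v) \<in> set ks \<Longrightarrow> N s \<le> m \<Longrightarrow> of_nat (N s) + v s \<le> (\<integral>\<^sup>+s'. of_nat (N s') \<partial>\<kappa> s)"
    and N: "\<And>\<kappa> v s s'. (\<kappa>, v) \<in> set ks \<Longrightarrow> s' \<in> set_pmf (\<kappa> s) \<Longrightarrow> N s \<le> N s'"
    and A: "\<And>\<kappa> v s s'. (\<kappa>, v) \<in> set ks \<Longrightarrow> s' \<in> set_pmf (\<kappa> s) \<Longrightarrow> A s \<subseteq> A s'"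
    and v: "\<And>\<kappa> v s s'. (\<kappa>, v) \<in> set ks \<Longrightarrow> A s \<subseteq> A s' \<Longrightarrow> v s' \<le> v s"
  shows "of_nat (N s) + (\<integral>\<^sup>+s'. indicator {s. N s \<le> m} s' * (\<Sum>(\<kappa>, v)\<leftarrow>ks. v s') \<partial>chain (map fst ks) s)
      \<le> (\<integral>\<^sup>+s'. of_nat (N s') \<partial>chain (map fst ks) s)"
  using assms
proof (induction ks arbitrary: s)
  case (Cons p ks)
  obtain \<kappa> v where p: "p = (\<kappa>, v)" by fastforce
  let ?c = "chain (map fst ks)"
  let ?w = "\<lambda>s'. indicator {s. N s \<le> m} s' * (\<Sum>(\<kappa>, v)\<leftarrow>ks. v s')"
  have N_mono: "N s \<le> N s'" if "(\<kappa>, v) \<in> set (p # ks)" "s' \<in> set_pmf (\<kappa> s)" for \<kappa> v s s'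
    using Cons.prems(2)[OF that] .
  have A_mono: "A s \<subseteq> A s'" if "(\<kappa>, v) \<in> set (p # ks)" "s' \<in> set_pmf (\<kappa> s)" for \<kappa> v s s'
    using Cons.prems(3)[OF that] .
  have IH: "of_nat (N s1) + (\<integral>\<^sup>+s'. ?w s' \<partial>?c s1) \<le> (\<integral>\<^sup>+s'. of_nat (N s') \<partial>?c s1)" for s1
  proof (rule Cons.IH)
    fix \<kappa> v s s'
    assume a: "(\<kappa>, v) \<in> set ks"
    then have a': "(\<kappa>, v) \<in> set (p # ks)" by simp
    show "N s \<le> m \<Longrightarrow> of_nat (N s) + v s \<le> (\<integral>\<^sup>+s'. of_nat (N s') \<partial>\<kappa> s)" using Cons.prems(1)[OF a'] .
    show "s' \<in> set_pmf (\<kappa> s) \<Longrightarrow> N s \<le> N s'" using N_mono[OF a'] .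
    show "s' \<in> set_pmf (\<kappa> s) \<Longrightarrow> A s \<subseteq> A s'" using A_mono[OF a'] .
    show "A s \<subseteq> A s' \<Longrightarrow> v s' \<le> v s" using Cons.prems(4)[OF a'] .
  qed
  \<comment> \<open>Growth is promised only while the counter is at most \<open>m\<close>. If it
    ends at most \<open>m\<close>, it also started so, as \<open>N\<close> never decreases; and
    \<open>v\<close> at the end is at most \<open>v s\<close>, as \<open>A\<close> has only
    grown.\<close>
  let ?m = "if N s \<le> m then v s else 0"
  have "(\<integral>\<^sup>+s1. \<integral>\<^sup>+s'. indicator {s. N s \<le> m} s' * v s' \<partial>?c s1 \<partial>\<kappa> s) \<le> (\<integral>\<^sup>+s'. ?m \<partial>bind_pmf (\<kappa> s) ?c)"
    unfolding nn_integral_bind_pmf[symmetric]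
  proof (rule nn_integral_mono_AE, unfold AE_measure_pmf_iff, intro ballI)
    fix s' assume s': "s' \<in> set_pmf (\<kappa> s \<bind> ?c)"
    then have s'': "s' \<in> set_pmf (chain (map fst (p # ks)) s)" by (simp add: p)
    have "N s \<le> N s' \<and> A s \<subseteq> A s'"
    proof (rule chain_invariant[OF _ _ s''])
      fix \<kappa>' s1 s2 assume "\<kappa>' \<in> set (map fst (p # ks))" "N s \<le> N s1 \<and> A s \<subseteq> A s1" "s2 \<in> set_pmf (\<kappa>' s1)"
      moreover from this(1) have "\<exists>v'. (\<kappa>', v') \<in> set (p # ks)"
        by (metis (no_types, lifting) imageE list.set_map prod.collapse)
      then obtain v' where "(\<kappa>', v') \<in> set (p # ks)" ..
      ultimately show "N s \<le> N s2 \<and> A s \<subseteq> A s2" using N_mono A_mono by (meson order_trans)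
    qed simp
    moreover have "v s' \<le> v s" if "A s \<subseteq> A s'" using Cons.prems(4)[OF _ that] by (auto simp: p)
    ultimately show "indicator {s. N s \<le> m} s' * v s' \<le> ?m" by (auto simp: indicator_def)
  qed
  also have "\<dots> = ?m" by simp
  finally have *: "(\<integral>\<^sup>+s1. \<integral>\<^sup>+s'. indicator {s. N s \<le> m} s' * v s' \<partial>?c s1 \<partial>\<kappa> s) \<le> ?m" .
  have "of_nat (N s) \<le> (\<integral>\<^sup>+s'. of_nat (N s') \<partial>\<kappa> s)"
  proof -
    have "(\<integral>\<^sup>+s'. of_nat (N s) \<partial>\<kappa> s) \<le> (\<integral>\<^sup>+s'. of_nat (N s') \<partial>\<kappa> s)"
      using N_mono[of \<kappa> v _ s] by (intro nn_integral_mono_AE) (auto simp: AE_measure_pmf_iff p)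
    then show ?thesis by simp
  qed
  then have gain': "of_nat (N s) + ?m \<le> (\<integral>\<^sup>+s'. of_nat (N s') \<partial>\<kappa> s)"
    using Cons.prems(1)[of \<kappa> v s] by (simp add: p)
  have "of_nat (N s) + (\<integral>\<^sup>+s'. indicator {s. N s \<le> m} s' * (\<Sum>(\<kappa>, v)\<leftarrow>p # ks. v s') \<partial>chain (map fst (p # ks)) s) =
      of_nat (N s) + ((\<integral>\<^sup>+s1. \<integral>\<^sup>+s'. indicator {s. N s \<le> m} s' * v s' \<partial>?c s1 \<partial>\<kappa> s) +
        (\<integral>\<^sup>+s1. \<integral>\<^sup>+s'. ?w s' \<partial>?c s1 \<partial>\<kappa> s))"
    by (simp add: p distrib_left nn_integral_add)
  also have "\<dots> \<le> of_nat (N s) + (?m + (\<integral>\<^sup>+s1. \<integral>\<^sup>+s'. ?w s' \<partial>?c s1 \<partial>\<kappa> s))"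
    using * by (intro add_mono) auto
  also have "\<dots> = (of_nat (N s) + ?m) + (\<integral>\<^sup>+s1. \<integral>\<^sup>+s'. ?w s' \<partial>?c s1 \<partial>\<kappa> s)" by (simp only: add.assoc)
  also have "\<dots> \<le> (\<integral>\<^sup>+s1. of_nat (N s1) \<partial>\<kappa> s) + (\<integral>\<^sup>+s1. \<integral>\<^sup>+s'. ?w s' \<partial>?c s1 \<partial>\<kappa> s)"
    using gain' by (intro add_mono) auto
  also have "\<dots> = (\<integral>\<^sup>+s1. of_nat (N s1) + (\<integral>\<^sup>+s'. ?w s' \<partial>?c s1) \<partial>\<kappa> s)"
    by (simp add: nn_integral_add)
  also have "\<dots> \<le> (\<integral>\<^sup>+s1. \<integral>\<^sup>+s'. of_nat (N s') \<partial>?c s1 \<partial>\<kappa> s)"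
    by (intro nn_integral_mono IH)
  also have "\<dots> = (\<integral>\<^sup>+s'. of_nat (N s') \<partial>chain (map fst (p # ks)) s)" by (simp add: p)
  finally show ?case .
qed simp

text \<open>Drawing all samples in advance or one per step makes no difference, because each step
  reads only its own sample.\<close>

lemma chain_of_replicate:
  "map_pmf (\<lambda>ys. fold f (zip js ys) s) (replicate_pmf (length js) P) =
     chain (map (\<lambda>j s. map_pmf (\<lambda>y. f (j, y) s) P) js) s"
proof (induction js arbitrary: s)
  case (Cons j js)
  have "map_pmf (\<lambda>ys. fold f (zip (j # js) ys) s) (replicate_pmf (length (j # js)) P) =
      P \<bind> (\<lambda>y. map_pmf (\<lambda>ys. fold f (zip js ys) (f (j, y) s)) (replicate_pmf (length js) P))"
    by (simp add: map_bind_pmf map_pmf_def[symmetric] pmf.map_comp comp_def)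
  also have "\<dots> = chain (map (\<lambda>j s. map_pmf (\<lambda>y. f (j, y) s) P) (j # js)) s"
    by (simp add: Cons.IH bind_map_pmf)
  finally show ?case .
qed simp

lemma chain_of_replicate2:
  "replicate_pmf k M \<bind> (\<lambda>Ss. map_pmf (\<lambda>ys. fold f (zip Ss ys) s) (replicate_pmf k P)) =
     chain (replicate k (\<lambda>s. P \<bind> (\<lambda>y. map_pmf (\<lambda>S. f (S, y) s) M))) s"
proof (induction k arbitrary: s)
  case (Suc k)
  have "replicate_pmf (Suc k) M \<bind> (\<lambda>Ss. map_pmf (\<lambda>ys. fold f (zip Ss ys) s) (replicate_pmf (Suc k) P)) =
      M \<bind> (\<lambda>S. replicate_pmf k M \<bind> (\<lambda>Ss. P \<bind> (\<lambda>y.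
        map_pmf (\<lambda>ys. fold f (zip Ss ys) (f (S, y) s)) (replicate_pmf k P))))"
    by (simp add: map_bind_pmf bind_assoc_pmf bind_return_pmf map_pmf_def)
  also have "\<dots> = M \<bind> (\<lambda>S. P \<bind> (\<lambda>y. replicate_pmf k M \<bind> (\<lambda>Ss.
        map_pmf (\<lambda>ys. fold f (zip Ss ys) (f (S, y) s)) (replicate_pmf k P))))"
    by (subst bind_commute_pmf) (rule refl)
  also have "\<dots> = P \<bind> (\<lambda>y. M \<bind> (\<lambda>S.
        chain (replicate k (\<lambda>s. P \<bind> (\<lambda>y. map_pmf (\<lambda>S. f (S, y) s) M))) (f (S, y) s)))"
    by (subst bind_commute_pmf) (simp only: Suc.IH)
  also have "\<dots> = chain (replicate (Suc k) (\<lambda>s. P \<bind> (\<lambda>y. map_pmf (\<lambda>S. f (S, y) s) M))) s"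
    by (simp add: bind_assoc_pmf bind_map_pmf)
  finally show ?case .
qed (simp add: bind_return_pmf)

lemma map_Pi_pmf_replicate_pmf:
  "map_pmf (\<lambda>x. map x [0..<s]) (Pi_pmf {..<s} d (\<lambda>_. P)) = replicate_pmf s P"
proof (induction s)
  case (Suc s)
  have eq: "map (f(s := y)) [0..<s] = map f [0..<s]" for f and y :: 'a by (intro map_cong) auto
  have "map_pmf (\<lambda>x. map x [0..<Suc s]) (Pi_pmf {..<Suc s} d (\<lambda>_. P)) =
      P \<bind> (\<lambda>y. Pi_pmf {..<s} d (\<lambda>_. P) \<bind> (\<lambda>x. return_pmf (map x [0..<s] @ [y])))"
    by (simp add: lessThan_Suc Pi_pmf_insert' map_bind_pmf eq)
  also have "\<dots> = P \<bind> (\<lambda>y. map_pmf (\<lambda>x. map x [0..<s]) (Pi_pmf {..<s} d (\<lambda>_. P)) \<bind> (\<lambda>xs. return_pmf (xs @ [y])))"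
    by (simp add: bind_map_pmf)
  also have "\<dots> = replicate_pmf s P \<bind> (\<lambda>xs. P \<bind> (\<lambda>y. return_pmf (xs @ [y])))"
    unfolding Suc.IH by (rule bind_commute_pmf)
  also have "\<dots> = replicate_pmf (Suc s) P"
    using replicate_pmf_distrib[of s 1 P] by (simp add: replicate_pmf_1 bind_map_pmf map_pmf_def bind_assoc_pmf bind_return_pmf)
  finally show ?case .
qed simp

section \<open>Growth of the idealised selection\<close>

definition probe_kernel ::
    "nat \<Rightarrow> nat \<Rightarrow> nat \<Rightarrow> bool list pmf \<Rightarrow> bool list list \<times> nat list \<Rightarrow> (bool list list \<times> nat list) pmf" where
  "probe_kernel m n T P s =
     P \<bind> (\<lambda>y. map_pmf (\<lambda>S. probe_step m id (S, y) s) (replicate_pmf T (pmf_of_set {..<n})))"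

text \<open>The index list is carried along so that probing and levels share one state space and can
  be concatenated into one chain.\<close>

definition ideal_kernel ::
    "nat \<Rightarrow> nat \<Rightarrow> bool list pmf \<Rightarrow> nat \<Rightarrow> bool list list \<times> nat list \<Rightarrow> (bool list list \<times> nat list) pmf" where
  "ideal_kernel m n P j s = map_pmf (\<lambda>y. apfst (ideal_step m n (j, y)) s) P"

text \<open>Here \<open>h\<close> bounds from below the chance that a step detects a sample at a
  given distance from the representatives; the integral is the resulting guaranteed growth.\<close>

definition expected_gap ::
    "nat \<Rightarrow> bool list pmf \<Rightarrow> (real \<Rightarrow> real) \<Rightarrow> bool list list \<times> nat list \<Rightarrow> ennreal" where
  "expected_gap n P h s = (\<integral>\<^sup>+y. ennreal (h (gap n (fst s) y)) \<partial>P)"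

lemma expected_gap_antimono:
  assumes "\<And>\<delta> \<delta>'. 0 \<le> \<delta> \<Longrightarrow> \<delta> \<le> \<delta>' \<Longrightarrow> \<delta>' \<le> 1 \<Longrightarrow> h \<delta> \<le> h \<delta>'" "set (fst s) \<subseteq> set (fst s')"
  shows "expected_gap n P h s' \<le> expected_gap n P h s"
  unfolding expected_gap_def
  by (intro nn_integral_mono ennreal_leI assms(1) gap_nonneg gap_le_1 gap_antimono assms(2))

text \<open>A sample without candidate is added for certain. A candidate need not be the nearest
  representative, but its distance is at least the gap, so \<open>T\<close> fresh indices miss the
  difference with probability at most \<open>(1 - gap) ^ T\<close>.\<close>

lemma probe_step_gain:
  assumes "0 < n" "length (fst s) \<le> m"
  shows "of_nat (length (fst s)) + ennreal (1 - (1 - gap n (fst s) y) ^ T) \<le>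
    (\<integral>\<^sup>+S. of_nat (length (fst (probe_step m id (S, y) s))) \<partial>replicate_pmf T (pmf_of_set {..<n}))"
proof -
  let ?M = "replicate_pmf T (pmf_of_set {..<n})"
  obtain R D where s: "s = (R, D)" by fastforce
  show ?thesis
  proof (cases "find (agree D y) R")
    case None
    have "ennreal (1 - (1 - gap n R y) ^ T) \<le> 1"
      using gap_le_1[of n R y] by simp
    then have "of_nat (length R) + ennreal (1 - (1 - gap n R y) ^ T) \<le> of_nat (length R) + 1"
      by (intro add_left_mono)
    moreover have "fst (probe_step m id (S, y) s) = y # R" for S
      using None assms(2) by (auto simp: probe_step_def s)
    ultimately show ?thesis by (simp add: s add.commute)
  next
    case (Some z)
    then have z: "z \<in> set R" by (auto dest: find_SomeD)
    have len: "of_nat (length (fst (probe_step m id (S, y) s))) =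
        of_nat (length R) + indicator {S. \<not> agree S y z} S" for S
      using Some assms(2) find_diff_None[of y z S]
      by (auto simp: probe_step_def s indicator_def add.commute split: option.split)
    have "measure_pmf.prob ?M {S. \<not> agree S y z} = 1 - measure_pmf.prob ?M {S. agree S y z}"
      using measure_pmf.prob_compl[of "{S. agree S y z}" ?M] by (simp add: Compl_eq_Diff_UNIV[symmetric] Collect_neg_eq)
    also have "\<dots> = 1 - (1 - hamming_dist n y z) ^ T" by (simp add: prob_agree_indices assms(1))
    also have "\<dots> \<ge> 1 - (1 - gap n R y) ^ T"
      using gap_le_hamming_dist[OF z, of n y] hamming_dist_le_1[of n y z]
      by (intro diff_left_mono power_mono) auto
    finally have "ennreal (1 - (1 - gap n R y) ^ T) \<le> emeasure ?M {S. \<not> agree S y z}"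
      by (simp add: measure_pmf.emeasure_eq_measure)
    then have "of_nat (length R) + ennreal (1 - (1 - gap n R y) ^ T) \<le>
        of_nat (length R) + emeasure ?M {S. \<not> agree S y z}" by (intro add_left_mono)
    also have "\<dots> = (\<integral>\<^sup>+S. of_nat (length R) + indicator {S. \<not> agree S y z} S \<partial>?M)"
      by (subst nn_integral_add) auto
    finally show ?thesis by (simp only: len) (simp add: s)
  qed
qed

lemma probe_kernel_gain:
  assumes "0 < n" "length (fst s) \<le> m"
  shows "of_nat (length (fst s)) + expected_gap n P (\<lambda>\<delta>. 1 - (1 - \<delta>) ^ T) s \<le>
    (\<integral>\<^sup>+s'. of_nat (length (fst s')) \<partial>probe_kernel m n T P s)"
proof -
  have "of_nat (length (fst s)) + expected_gap n P (\<lambda>\<delta>. 1 - (1 - \<delta>) ^ T) s =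
      (\<integral>\<^sup>+y. of_nat (length (fst s)) + ennreal (1 - (1 - gap n (fst s) y) ^ T) \<partial>P)"
    by (subst nn_integral_add) (auto simp: expected_gap_def)
  also have "\<dots> \<le> (\<integral>\<^sup>+y. (\<integral>\<^sup>+S. of_nat (length (fst (probe_step m id (S, y) s)))
      \<partial>replicate_pmf T (pmf_of_set {..<n})) \<partial>P)"
    by (intro nn_integral_mono probe_step_gain assms)
  also have "\<dots> = (\<integral>\<^sup>+s'. of_nat (length (fst s')) \<partial>probe_kernel m n T P s)"
    by (simp only: probe_kernel_def nn_integral_bind_pmf nn_integral_map_pmf)
  finally show ?thesis .
qed

lemma ideal_kernel_gain:
  assumes "length (fst s) \<le> m"
  shows "of_nat (length (fst s)) + expected_gap n P (\<lambda>\<delta>. of_bool (1 / 2 ^ Suc j < \<delta>)) s \<le>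
    (\<integral>\<^sup>+s'. of_nat (length (fst s')) \<partial>ideal_kernel m n P j s)"
proof -
  obtain R D where s: "s = (R, D)" by fastforce
  have "of_nat (length R) + ennreal (of_bool (1 / 2 ^ Suc j < gap n R y)) \<le>
      of_nat (length (ideal_step m n (j, y) R))" for y
  proof (cases "1 / 2 ^ Suc j < gap n R y")
    case True
    then have "ideal_accept m n (j, y) R"
      using assms unfolding ideal_accept_def s
      by (auto intro: less_le_trans gap_le_hamming_dist simp del: power_Suc)
    with True show ?thesis by (simp add: ideal_step_def add.commute)
  next
    case False
    then show ?thesis by (auto simp: ideal_step_def)
  qed
  then have "(\<integral>\<^sup>+y. of_nat (length R) + ennreal (of_bool (1 / 2 ^ Suc j < gap n R y)) \<partial>P) \<le>
      (\<integral>\<^sup>+y. of_nat (length (ideal_step m n (j, y) R)) \<partial>P)"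
    by (intro nn_integral_mono)
  moreover have "(\<integral>\<^sup>+y. of_nat (length R) + ennreal (of_bool (1 / 2 ^ Suc j < gap n R y)) \<partial>P) =
      of_nat (length R) + expected_gap n P (\<lambda>\<delta>. of_bool (1 / 2 ^ Suc j < \<delta>)) s"
    by (subst nn_integral_add) (auto simp: expected_gap_def s)
  ultimately show ?thesis
    by (simp add: s ideal_kernel_def del: power_Suc)
qed

lemma probe_kernel_mono:
  assumes "s' \<in> set_pmf (probe_kernel m n T P s)"
  shows "length (fst s) \<le> length (fst s')" "set (fst s) \<subseteq> set (fst s')"
    "length (fst s') \<le> max (Suc m) (length (fst s))"
    "set (fst s') \<subseteq> set (fst s) \<union> set_pmf P"
proof -
  obtain R D R' D' where s: "s = (R, D)" "s' = (R', D')" by fastforce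
  from assms obtain S y where y: "y \<in> set_pmf P" "probe_step m id (S, y) (R, D) = (R', D')"
    by (auto simp: probe_kernel_def s)
  from probe_step_mono[OF y(2)] show "length (fst s) \<le> length (fst s')" "set (fst s) \<subseteq> set (fst s')"
    "length (fst s') \<le> max (Suc m) (length (fst s))" by (auto simp: s)
  show "set (fst s') \<subseteq> set (fst s) \<union> set_pmf P"
    using set_fold_probe_step_subset[of m id "[(S, y)]" "(R, D)"] y by (auto simp: s)
qed

lemma ideal_kernel_mono:
  assumes "s' \<in> set_pmf (ideal_kernel m n P j s)"
  shows "length (fst s) \<le> length (fst s')" "set (fst s) \<subseteq> set (fst s')"
    "length (fst s') \<le> max (Suc m) (length (fst s))"
    "set (fst s') \<subseteq> set (fst s) \<union> set_pmf P"
proof -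
  from assms obtain y where "y \<in> set_pmf P" "fst s' = ideal_step m n (j, y) (fst s)"
    by (auto simp: ideal_kernel_def)
  then show "length (fst s) \<le> length (fst s')" "set (fst s) \<subseteq> set (fst s')"
    "length (fst s') \<le> max (Suc m) (length (fst s))" "set (fst s') \<subseteq> set (fst s) \<union> set_pmf P"
    by (auto simp: ideal_step_def ideal_accept_def)
qed

lemma sum_list_expected_gap:
  assumes "\<And>h \<delta>. h \<in> set hs \<Longrightarrow> 0 \<le> \<delta> \<Longrightarrow> \<delta> \<le> 1 \<Longrightarrow> 0 \<le> h \<delta>"
  shows "(\<Sum>h\<leftarrow>hs. expected_gap n P h s) = expected_gap n P (\<lambda>\<delta>. \<Sum>h\<leftarrow>hs. h \<delta>) s"
  using assms
proof (induction hs)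
  case (Cons h hs)
  have "0 \<le> (\<Sum>h\<leftarrow>hs. h (gap n (fst s) y))" for y
    using Cons.prems gap_nonneg gap_le_1 by (intro sum_list_nonneg) auto
  then have "ennreal (h (gap n (fst s) y) + (\<Sum>h\<leftarrow>hs. h (gap n (fst s) y))) =
      ennreal (h (gap n (fst s) y)) + ennreal (\<Sum>h\<leftarrow>hs. h (gap n (fst s) y))" for y
    using Cons.prems gap_nonneg gap_le_1 by (intro ennreal_plus) auto
  then show ?case
    using Cons by (simp add: expected_gap_def nn_integral_add)
qed (simp add: expected_gap_def)

text \<open>The hybrid combines actual probing with idealised levels. Distances below
  \<open>\<epsilon> / 2\<close> contribute at most half of the expected gap, so \<open>rate\<close>
  may ignore them. Every final state with at most \<open>m\<close> representatives then has total
  guaranteed growth at least \<open>a * \<epsilon> / 2\<close>, while the expected count is at most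
  \<open>Suc m\<close>.\<close>

lemma prob_hybrid_le:
  assumes P: "P \<in> distributions n" and n: "0 < n"
    and far: "far_from n \<epsilon> (supported_on_at_most n m) P" and "\<epsilon> < 1" "0 \<le> a"
    and rate: "\<And>\<delta>. 0 \<le> \<delta> \<Longrightarrow> \<delta> \<le> 1 \<Longrightarrow>
      a * (\<delta> - \<epsilon> / 2) \<le> real c * (1 - (1 - \<delta>) ^ T) + (\<Sum>j\<leftarrow>js. of_bool (1 / 2 ^ Suc j < \<delta>))"
  shows "measure_pmf.prob (chain (replicate c (probe_kernel m n T P) @ map (ideal_kernel m n P) js) ([], []))
      {s. length (fst s) \<le> m} * (a * \<epsilon> / 2) \<le> real (Suc m)"
proof -
  define h1 :: "real \<Rightarrow> real" where "h1 = (\<lambda>\<delta>. 1 - (1 - \<delta>) ^ T)"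
  define h2 :: "nat \<Rightarrow> real \<Rightarrow> real" where "h2 = (\<lambda>j \<delta>. of_bool (1 / 2 ^ Suc j < \<delta>))"
  define hs where "hs = replicate c h1 @ map h2 js"
  define ks where "ks = replicate c (probe_kernel m n T P, expected_gap n P h1) @
    map (\<lambda>j. (ideal_kernel m n P j, expected_gap n P (h2 j))) js"
  define N where "N = (\<lambda>s :: bool list list \<times> nat list. length (fst s))"
  define A where "A = (\<lambda>s :: bool list list \<times> nat list. set (fst s))"
  let ?H = "chain (map fst ks) ([], [])"
  have ks: "map fst ks = replicate c (probe_kernel m n T P) @ map (ideal_kernel m n P) js"
    by (simp add: ks_def comp_def)
  have sum_ks: "(\<Sum>(\<kappa>, v)\<leftarrow>ks. v s) = (\<Sum>h\<leftarrow>hs. expected_gap n P h s)" for s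
    by (simp add: ks_def hs_def comp_def)
  have h_mono: "h \<delta> \<le> h \<delta>'" if "h \<in> set hs" "0 \<le> \<delta>" "\<delta> \<le> \<delta>'" "\<delta>' \<le> 1" for h \<delta> \<delta>'
  proof -
    have "(1 - \<delta>') ^ T \<le> (1 - \<delta>) ^ T" using that by (intro power_mono) auto
    then show ?thesis using that by (auto simp: hs_def h1_def h2_def simp del: power_Suc)
  qed
  have h_nonneg: "0 \<le> h \<delta>" if "h \<in> set hs" "0 \<le> \<delta>" "\<delta> \<le> 1" for h \<delta>
  proof -
    have "(1 - \<delta>) ^ T \<le> 1" using that by (intro power_le_one) auto
    then show ?thesis using that by (auto simp: hs_def h1_def h2_def simp del: power_Suc)
  qed
  have cases: "\<kappa> = probe_kernel m n T P \<and> v = expected_gap n P h1 \<and> h1 \<in> set hs \<or>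
      (\<exists>j. \<kappa> = ideal_kernel m n P j \<and> v = expected_gap n P (h2 j) \<and> h2 j \<in> set hs)" if "(\<kappa>, v) \<in> set ks" for \<kappa> v
    using that by (auto simp: ks_def hs_def)
  have bound: "of_nat (N ([], [])) + (\<integral>\<^sup>+s'. indicator {s. N s \<le> m} s' * (\<Sum>(\<kappa>, v)\<leftarrow>ks. v s') \<partial>?H)
      \<le> (\<integral>\<^sup>+s'. of_nat (N s') \<partial>?H)"
  proof (rule chain_expected_counter[where A = A])
    fix \<kappa> v s s' assume k: "(\<kappa>, v) \<in> set ks"
    show "of_nat (N s) + v s \<le> (\<integral>\<^sup>+s'. of_nat (N s') \<partial>\<kappa> s)" if "N s \<le> m"
      using cases[OF k] probe_kernel_gain[OF n] ideal_kernel_gain that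
      unfolding N_def h1_def h2_def by blast
    show "N s \<le> N s'" "A s \<subseteq> A s'" if "s' \<in> set_pmf (\<kappa> s)"
      using cases[OF k] probe_kernel_mono(1,2)[of s' m n T P s] ideal_kernel_mono(1,2)[of s' m n P _ s] that
      unfolding N_def A_def by auto
    show "v s' \<le> v s" if "A s \<subseteq> A s'"
    proof -
      have sub: "set (fst s) \<subseteq> set (fst s')" using that unfolding A_def .
      have "expected_gap n P h s' \<le> expected_gap n P h s" if "h \<in> set hs" for h
        using h_mono[OF that] sub by (rule expected_gap_antimono)
      then show ?thesis using cases[OF k] by blast
    qed
  qed
  \<comment> \<open>The counter overshoots \<open>m\<close> by at most one, which bounds its
    expectation; representatives lie in the support, so they have length \<open>n\<close>, as the
    farness argument requires.\<close>
  have inv: "N s \<le> Suc m \<and> A s \<subseteq> set_pmf P" if "s \<in> set_pmf ?H" for s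
  proof (rule chain_invariant[OF _ _ that])
    fix \<kappa> s1 s2 assume "\<kappa> \<in> set (map fst ks)" "N s1 \<le> Suc m \<and> A s1 \<subseteq> set_pmf P" "s2 \<in> set_pmf (\<kappa> s1)"
    then show "N s2 \<le> Suc m \<and> A s2 \<subseteq> set_pmf P"
      using probe_kernel_mono(3,4)[of s2 m n T P s1] ideal_kernel_mono(3,4)[of s2 m n P _ s1]
      unfolding N_def A_def ks set_append set_map by (fastforce simp: max_def split: if_splits)
  qed (simp add: N_def A_def)
  have big: "ennreal (a * \<epsilon> / 2) \<le> (\<Sum>(\<kappa>, v)\<leftarrow>ks. v s)" if "s \<in> set_pmf ?H" "N s \<le> m" for s
  proof -
    define F where "F = (\<lambda>y. \<Sum>h\<leftarrow>hs. h (gap n (fst s) y))"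
    have fin: "finite (set_pmf P)" by (rule finite_set_pmf_distributions[OF P])
    have F_ge: "a * (gap n (fst s) y - \<epsilon> / 2) \<le> F y" for y
      using rate[OF gap_nonneg gap_le_1, of n "fst s" y]
      by (simp add: F_def hs_def h1_def h2_def comp_def sum_list_replicate del: power_Suc)
    have F_nonneg: "0 \<le> F y" for y
      using h_nonneg gap_nonneg gap_le_1 by (auto simp: F_def intro!: sum_list_nonneg)
    have "\<epsilon> < measure_pmf.expectation P (gap n (fst s))"
      using inv[OF that(1)] that(2) P
      by (intro far_from_imp_expectation_gap[OF P far]) (auto simp: N_def A_def distributions_def \<open>\<epsilon> < 1\<close>)
    then have "a * \<epsilon> \<le> a * measure_pmf.expectation P (gap n (fst s))"
      using \<open>0 \<le> a\<close> by (intro mult_left_mono) auto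
    then have "a * \<epsilon> / 2 \<le> a * (measure_pmf.expectation P (gap n (fst s)) - \<epsilon> / 2)"
      by (simp add: algebra_simps)
    also have "\<dots> = measure_pmf.expectation P (\<lambda>y. a * (gap n (fst s) y - \<epsilon> / 2))"
      by (simp add: integrable_measure_pmf_finite[OF fin])
    also have "\<dots> \<le> measure_pmf.expectation P F"
      by (intro integral_mono F_ge integrable_measure_pmf_finite fin)
    finally have "ennreal (a * \<epsilon> / 2) \<le> ennreal (measure_pmf.expectation P F)" by (rule ennreal_leI)
    also have "\<dots> = (\<integral>\<^sup>+y. ennreal (F y) \<partial>P)"
      by (rule nn_integral_eq_integral[symmetric]) (auto intro: integrable_measure_pmf_finite fin F_nonneg)
    also have "\<dots> = expected_gap n P (\<lambda>\<delta>. \<Sum>h\<leftarrow>hs. h \<delta>) s"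
      by (simp only: expected_gap_def F_def)
    also have "\<dots> = (\<Sum>(\<kappa>, v)\<leftarrow>ks. v s)"
      unfolding sum_ks by (rule sum_list_expected_gap[symmetric]) (rule h_nonneg)
    finally show ?thesis .
  qed
  have "emeasure ?H {s. N s \<le> m} * ennreal (a * \<epsilon> / 2) = (\<integral>\<^sup>+s'. indicator {s. N s \<le> m} s' * ennreal (a * \<epsilon> / 2) \<partial>?H)"
    by (simp add: nn_integral_multc)
  also have "\<dots> \<le> (\<integral>\<^sup>+s'. indicator {s. N s \<le> m} s' * (\<Sum>(\<kappa>, v)\<leftarrow>ks. v s') \<partial>?H)"
    using big by (intro nn_integral_mono_AE) (auto simp: AE_measure_pmf_iff indicator_def)
  also have "\<dots> \<le> (\<integral>\<^sup>+s'. of_nat (N s') \<partial>?H)"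
    using bound by (simp add: N_def)
  also have "\<dots> \<le> (\<integral>\<^sup>+s'. of_nat (Suc m) \<partial>?H)"
    using inv by (intro nn_integral_mono_AE) (auto simp: AE_measure_pmf_iff simp del: of_nat_Suc)
  also have "\<dots> = ennreal (real (Suc m))" by (simp add: ennreal_of_nat_eq_real_of_nat del: of_nat_Suc)
  finally have "ennreal (measure_pmf.prob ?H {s. N s \<le> m} * (a * \<epsilon> / 2)) \<le> ennreal (real (Suc m))"
    by (simp only: measure_pmf.emeasure_eq_measure ennreal_mult'[OF measure_nonneg])
  then show ?thesis by (simp add: N_def ks del: of_nat_Suc)
qed

section \<open>The test\<close>

lemma fold_apfst: "fst (fold (\<lambda>p. apfst (f p)) ps s) = fold f ps (fst s)"
  by (induction ps arbitrary: s) simp_all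

lemma map_replicate_pmf_add:
  "map_pmf g (replicate_pmf (k + l) p) =
     replicate_pmf k p \<bind> (\<lambda>us. map_pmf (\<lambda>vs. g (us @ vs)) (replicate_pmf l p))"
  by (simp add: replicate_pmf_distrib map_bind_pmf map_pmf_def bind_assoc_pmf bind_return_pmf)

lemma prob_bind_pmf_le:
  assumes "\<And>x. x \<in> set_pmf M \<Longrightarrow> x \<notin> B \<Longrightarrow> measure_pmf.prob (f x) A \<le> \<eta>" "0 \<le> \<eta>"
  shows "measure_pmf.prob (M \<bind> f) A \<le> measure_pmf.prob M B + \<eta>"
proof -
  have "emeasure (bind_pmf M f) A = (\<integral>\<^sup>+x. emeasure (f x) A \<partial>M)"
    by (rule emeasure_bind_pmf)
  also have "\<dots> \<le> (\<integral>\<^sup>+x. indicator B x + ennreal \<eta> \<partial>M)"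
  proof (intro nn_integral_mono_AE, unfold AE_measure_pmf_iff, intro ballI)
    fix x assume "x \<in> set_pmf M"
    with assms(1)[of x] show "emeasure (f x) A \<le> indicator B x + ennreal \<eta>"
      by (cases "x \<in> B")
        (auto simp: measure_pmf.emeasure_eq_measure intro!: add_increasing2 ennreal_leI)
  qed
  also have "\<dots> = emeasure M B + ennreal \<eta>" by (subst nn_integral_add) auto
  finally show ?thesis
    using assms(2) by (simp add: measure_pmf.emeasure_eq_measure flip: ennreal_plus)
qed

text \<open>
  The first \<open>c\<close> samples are probed: \<open>D\<close> singles out one candidate representative \<open>z\<close>, and \<open>z\<close> is
  compared with the sample on fresh random indices. Sample \<open>c + i\<close> is read on the first
  \<open>2 ^ Suc (js ! i) * K\<close> entries of the common index list \<open>I\<close>, on which all representatives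
  may be read completely.
\<close>

definition real_reps ::
    "nat \<Rightarrow> nat \<Rightarrow> nat \<Rightarrow> nat list \<Rightarrow> nat list \<Rightarrow> nat list list \<Rightarrow> bool list list \<Rightarrow> bool list list" where
  "real_reps m K c js I Ss xs =
     fold (level_step m id) (zip (map (\<lambda>j. take (2 ^ Suc j * K) I) js) (drop c xs))
       (fst (fold (probe_step m id) (zip Ss (take c xs)) ([], [])))"

text \<open>Probing is kept as it is, since its indices are fresh for each sample; only the levels
  are idealised. Both selections thus enter the levels with the same representatives.\<close>

definition ideal_reps ::
    "nat \<Rightarrow> nat \<Rightarrow> nat \<Rightarrow> nat list \<Rightarrow> nat list list \<Rightarrow> bool list list \<Rightarrow> bool list list" where
  "ideal_reps m n c js Ss xs =
     fold (ideal_step m n) (zip js (drop c xs))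
       (fst (fold (probe_step m id) (zip Ss (take c xs)) ([], [])))"

definition index_tree :: "nat \<Rightarrow> nat \<Rightarrow> nat \<Rightarrow> nat list \<Rightarrow> nat list \<Rightarrow> nat list list \<Rightarrow> dtree" where
  "index_tree m K c js I Ss =
     probe_tree m (zip Ss [0..<c]) [] []
       (level_tree m (zip (map (\<lambda>j. take (2 ^ Suc j * K) I) js) [c..<c + length js]))"

text \<open>The summands are: probed samples matched on \<open>D\<close> and compared with a
  candidate; representatives on \<open>D\<close>; level samples on their prefixes; representatives
  on the common index list of length \<open>N\<close>.\<close>

definition query_bound :: "nat \<Rightarrow> nat \<Rightarrow> nat \<Rightarrow> nat \<Rightarrow> nat list \<Rightarrow> nat \<Rightarrow> nat" where
  "query_bound m K c T js N =
     c * (Suc m + 2 * T) + Suc m * c + (\<Sum>j\<leftarrow>js. 2 ^ Suc j * K) + Suc m * N"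

lemma map_apsnd_zip: "map (apsnd f) (zip xs ys) = zip xs (map f ys)"
  by (induction xs ys rule: list_induct2') auto

lemma map_apfst_zip: "map (apfst f) (zip xs ys) = zip (map f xs) ys"
  by (induction xs ys rule: list_induct2') auto

lemma run_index_tree:
  assumes "length Ss = c"
  shows "run (index_tree m K c js I Ss) x \<longleftrightarrow>
    length (real_reps m K c js I Ss (map x [0..<c + length js])) \<le> m"
proof -
  let ?xs = "map x [0..<c + length js]"
  let ?s = "fold (probe_step m x) (zip Ss [0..<c]) ([], [])"
  let ?Js = "map (\<lambda>j. take (2 ^ Suc j * K) I) js"
  have xs: "take c ?xs = map x [0..<c]" "drop c ?xs = map x [c..<c + length js]"
    by (simp_all add: take_map drop_map)
  have "apfst (map x) ?s = fold (probe_step m id) (zip Ss (take c ?xs)) ([], [])"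
    by (simp only: fold_probe_step_map xs map_apsnd_zip) simp
  then have s: "fst (fold (probe_step m id) (zip Ss (take c ?xs)) ([], [])) = map x (fst ?s)"
    by (metis fst_apfst)
  have "map x (fold (level_step m x) (zip ?Js [c..<c + length js]) (fst ?s)) =
      real_reps m K c js I Ss ?xs"
    unfolding real_reps_def s by (simp only: fold_level_step_map xs map_apsnd_zip)
  from arg_cong[OF this, of length] show ?thesis
    by (simp add: index_tree_def run_probe_tree run_level_tree del: upt_Suc)
qed

lemma distinct_real_reps: "distinct (real_reps m K c js I Ss xs)"
  unfolding real_reps_def
  by (intro distinct_fold_level_step distinct_fold_probe_step) (simp add: told_apart_def)

lemma set_real_reps: "set (real_reps m K c js I Ss xs) \<subseteq> set xs"
proof -
  have "snd ` set (zip Ss (take c xs)) \<subseteq> set xs"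
    by (auto dest!: set_zip_rightD in_set_takeD)
  moreover have "snd ` set (zip Js (drop c xs)) \<subseteq> set xs" for Js :: "nat list list"
    by (auto dest!: set_zip_rightD in_set_dropD)
  ultimately show ?thesis
    unfolding real_reps_def using set_fold_level_step_subset set_fold_probe_step_subset
    by (smt (verit, best) Un_iff empty_iff fst_conv list.set(1) subset_iff)
qed

lemma queries_within_index_tree:
  assumes "length Ss = c" "\<forall>S\<in>set Ss. \<forall>i\<in>set S. i < n" "\<forall>i\<in>set I. i < n"
  shows "queries_within (c + length js) n (index_tree m K c js I Ss)"
  unfolding index_tree_def
proof (rule queries_within_probe_tree)
  show "\<forall>p\<in>set (zip Ss [0..<c]). snd p < c + length js \<and> (\<forall>i\<in>set (fst p). i < n)"
    using assms by (fastforce dest: set_zip_leftD set_zip_rightD)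
  fix R assume R: "\<forall>z\<in>set R. z < c + length js"
  show "queries_within (c + length js) n
      (level_tree m (zip (map (\<lambda>j. take (2 ^ Suc j * K) I) js) [c..<c + length js]) R)"
  proof (rule queries_within_level_tree[OF _ R])
    show "\<forall>p\<in>set (zip (map (\<lambda>j. take (2 ^ Suc j * K) I) js) [c..<c + length js]).
        snd p < c + length js \<and> (\<forall>i\<in>set (fst p). i < n)"
      using assms(3) by (fastforce dest: set_zip_leftD set_zip_rightD in_set_takeD)
  qed
qed auto

lemma card_queried_index_tree:
  assumes "length Ss = c" "\<forall>S\<in>set Ss. length S = T" "length I = N"
  shows "card (queried (index_tree m K c js I Ss) x) \<le> query_bound m K c T js N"
proof -
  let ?ps = "zip Ss [0..<c]" and ?qs = "zip (map (\<lambda>j. take (2 ^ Suc j * K) I) js) [c..<c + length js]"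
  have "card (queried (index_tree m K c js I Ss) x) \<le>
      (\<Sum>p\<leftarrow>?ps. Suc m + 2 * length (fst p)) + Suc m * length ?ps
      + (\<Sum>p\<leftarrow>?qs. length (fst p)) + Suc m * card (set I)"
    unfolding index_tree_def
    by (rule card_queried_probe_level_tree) (auto dest!: set_zip_leftD in_set_takeD)
  also have "(\<Sum>p\<leftarrow>?ps. Suc m + 2 * length (fst p)) = (\<Sum>p\<leftarrow>?ps. Suc m + 2 * T)"
    using assms(2) by (intro arg_cong[where f = sum_list] map_cong) (auto dest: set_zip_leftD)
  also have "(\<Sum>p\<leftarrow>?ps. Suc m + 2 * T) = c * (Suc m + 2 * T)"
    using assms(1) by (simp add: sum_list_triv)
  also have "length ?ps = c" using assms(1) by simp
  also have "(\<Sum>p\<leftarrow>?qs. length (fst p)) = (\<Sum>J\<leftarrow>map fst ?qs. length J)" by (simp only: map_map comp_def)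
  also have "map fst ?qs = map (\<lambda>j. take (2 ^ Suc j * K) I) js" by simp
  also have "(\<Sum>J\<leftarrow>map (\<lambda>j. take (2 ^ Suc j * K) I) js. length J) \<le> (\<Sum>j\<leftarrow>js. 2 ^ Suc j * K)"
    unfolding map_map by (intro sum_list_mono) simp
  also have "Suc m * card (set I) \<le> Suc m * N"
    using card_length[of I] assms(3) by (intro mult_le_mono2) simp
  finally show ?thesis by (simp add: query_bound_def)
qed

lemma hybrid_chain:
  "(replicate_pmf c (replicate_pmf T (pmf_of_set {..<n})) \<bind> (\<lambda>Ss.
      map_pmf (\<lambda>xs. ideal_reps m n c js Ss xs) (replicate_pmf (c + length js) P))) =
    map_pmf fst (chain (replicate c (probe_kernel m n T P) @ map (ideal_kernel m n P) js) ([], []))"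
proof -
  let ?S = "replicate_pmf c (replicate_pmf T (pmf_of_set {..<n}))"
  let ?f = "\<lambda>p. apfst (ideal_step m n p)"
  let ?s = "\<lambda>Ss us. fold (probe_step m id) (zip Ss us) ([], [])"
  have "(?S \<bind> (\<lambda>Ss. map_pmf (\<lambda>xs. ideal_reps m n c js Ss xs) (replicate_pmf (c + length js) P))) =
      ?S \<bind> (\<lambda>Ss. replicate_pmf c P \<bind> (\<lambda>us.
        map_pmf fst (map_pmf (\<lambda>vs. fold ?f (zip js vs) (?s Ss us)) (replicate_pmf (length js) P))))"
  proof (intro bind_pmf_cong refl, unfold map_replicate_pmf_add, intro bind_pmf_cong refl)
    fix Ss us assume "us \<in> set_pmf (replicate_pmf c P)"
    then have "length us = c" by (simp add: set_replicate_pmf)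
    then show "map_pmf (\<lambda>vs. ideal_reps m n c js Ss (us @ vs)) (replicate_pmf (length js) P) =
        map_pmf fst (map_pmf (\<lambda>vs. fold ?f (zip js vs) (?s Ss us)) (replicate_pmf (length js) P))"
      by (simp add: pmf.map_comp comp_def ideal_reps_def fold_apfst)
  qed
  also have "\<dots> = ?S \<bind> (\<lambda>Ss. replicate_pmf c P \<bind> (\<lambda>us.
      map_pmf fst (chain (map (ideal_kernel m n P) js) (?s Ss us))))"
    by (simp only: chain_of_replicate ideal_kernel_def[abs_def])
  also have "\<dots> = map_pmf fst ((?S \<bind> (\<lambda>Ss. map_pmf (?s Ss) (replicate_pmf c P))) \<bind>
      chain (map (ideal_kernel m n P) js))"
    by (simp only: map_bind_pmf bind_assoc_pmf bind_map_pmf)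
  also have "(?S \<bind> (\<lambda>Ss. map_pmf (?s Ss) (replicate_pmf c P))) = chain (replicate c (probe_kernel m n T P)) ([], [])"
    by (simp only: chain_of_replicate2 probe_kernel_def[abs_def])
  finally show ?thesis by (simp only: chain_append)
qed

text \<open>Two errors of at most \<open>1 / 10\<close> are added: the idealised selection ends with
  at most \<open>m\<close> representatives, or it exceeds \<open>m\<close> and some critical pair
  agrees on its prefix.\<close>

lemma prob_real_reps_le:
  assumes P: "P \<in> distributions n" and n: "0 < n"
    and far: "far_from n \<epsilon> (supported_on_at_most n m) P" and "\<epsilon> < 1" "0 \<le> a"
    and rate: "\<And>\<delta>. 0 \<le> \<delta> \<Longrightarrow> \<delta> \<le> 1 \<Longrightarrow>
      a * (\<delta> - \<epsilon> / 2) \<le> real c * (1 - (1 - \<delta>) ^ T) + (\<Sum>j\<leftarrow>js. of_bool (1 / 2 ^ Suc j < \<delta>))"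
    and a: "20 * real (Suc m) \<le> a * \<epsilon>"
    and K: "real (m * Suc m) * exp (- real K) \<le> 1 / 10"
    and js: "sorted_wrt (\<ge>) js" "\<forall>j\<in>set js. j < L"
  shows "measure_pmf.prob
      (replicate_pmf (2 ^ L * K) (pmf_of_set {..<n}) \<bind> (\<lambda>I.
        replicate_pmf c (replicate_pmf T (pmf_of_set {..<n})) \<bind> (\<lambda>Ss.
        map_pmf (real_reps m K c js I Ss) (replicate_pmf (c + length js) P))))
      {R. length R \<le> m} \<le> 1 / 5"
proof -
  let ?I = "replicate_pmf (2 ^ L * K) (pmf_of_set {..<n})"
  let ?S = "replicate_pmf c (replicate_pmf T (pmf_of_set {..<n}))"
  let ?X = "replicate_pmf (c + length js) P"
  define Y where "Y = ?S \<bind> (\<lambda>Ss. map_pmf (Pair Ss) ?X)"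
  define B where "B = {z. length (ideal_reps m n c js (fst z) (snd z)) \<le> m}"
  let ?H = "chain (replicate c (probe_kernel m n T P) @ map (ideal_kernel m n P) js) ([], [])"
  have "(?I \<bind> (\<lambda>I. ?S \<bind> (\<lambda>Ss. map_pmf (real_reps m K c js I Ss) ?X))) =
      Y \<bind> (\<lambda>(Ss, xs). map_pmf (\<lambda>I. real_reps m K c js I Ss xs) ?I)"
  \<comment> \<open>The draws are reordered so that \<open>I\<close> comes last and is independent
    of the fixed samples and probing indices.\<close>
  proof -
    have "(?I \<bind> (\<lambda>I. ?S \<bind> (\<lambda>Ss. map_pmf (real_reps m K c js I Ss) ?X))) =
        ?S \<bind> (\<lambda>Ss. ?I \<bind> (\<lambda>I. map_pmf (real_reps m K c js I Ss) ?X))"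
      by (rule bind_commute_pmf)
    also have "\<dots> = ?S \<bind> (\<lambda>Ss. ?X \<bind> (\<lambda>xs. map_pmf (\<lambda>I. real_reps m K c js I Ss xs) ?I))"
      unfolding map_pmf_def by (subst bind_commute_pmf) (rule refl)
    finally show ?thesis by (simp add: Y_def bind_assoc_pmf bind_map_pmf)
  qed
  moreover have "measure_pmf.prob (Y \<bind> (\<lambda>(Ss, xs). map_pmf (\<lambda>I. real_reps m K c js I Ss xs) ?I)) {R. length R \<le> m}
      \<le> measure_pmf.prob Y B + 1 / 10"
  proof (rule prob_bind_pmf_le)
    fix z assume z: "z \<in> set_pmf Y" "z \<notin> B"
    obtain Ss xs where zz: "z = (Ss, xs)" by fastforce
    have len: "length xs = c + length js" using z by (auto simp: Y_def zz set_replicate_pmf)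
    let ?Z = "fst (fold (probe_step m id) (zip Ss (take c xs)) ([], []))"
    have "measure_pmf.prob ?I
        {I. length (fold (level_step m id) (map (apfst (\<lambda>j. take (2 ^ Suc j * K) I)) (zip js (drop c xs))) ?Z) \<le> m}
      \<le> real (m * Suc m) * exp (- real K)"
    proof (rule prob_level_le[OF n])
      show "sorted_wrt (\<ge>) (map fst (zip js (drop c xs)))" using js(1) len by simp
      show "\<forall>p\<in>set (zip js (drop c xs)). fst p < L" using js(2) by (auto dest: set_zip_leftD)
      show "distinct ?Z" by (intro distinct_fold_probe_step) (simp add: told_apart_def)
      show "m < length (fold (ideal_step m n) (zip js (drop c xs)) ?Z)"
        using z(2) unfolding zz B_def ideal_reps_def by simp
    qed
    with K show "measure_pmf.prob (case z of (Ss, xs) \<Rightarrow> map_pmf (\<lambda>I. real_reps m K c js I Ss xs) ?I)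
        {R. length R \<le> m} \<le> 1 / 10"
      by (simp add: zz measure_map_pmf vimage_def real_reps_def map_apfst_zip del: power_Suc)
  qed simp
  moreover have "measure_pmf.prob Y B = measure_pmf.prob ?H {s. length (fst s) \<le> m}"
  proof -
    have "measure_pmf.prob Y B = measure_pmf.prob (map_pmf (\<lambda>(Ss, xs). ideal_reps m n c js Ss xs) Y) {R. length R \<le> m}"
      by (simp add: measure_map_pmf vimage_def B_def case_prod_beta)
    also have "map_pmf (\<lambda>(Ss, xs). ideal_reps m n c js Ss xs) Y = map_pmf fst ?H"
      unfolding hybrid_chain[symmetric] Y_def by (simp add: map_bind_pmf pmf.map_comp comp_def)
    finally show ?thesis by (simp add: measure_map_pmf vimage_def)
  qed
  moreover have "measure_pmf.prob ?H {s. length (fst s) \<le> m} \<le> 1 / 10"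
  proof -
    let ?p = "measure_pmf.prob ?H {s. length (fst s) \<le> m}"
    have "?p * (10 * real (Suc m)) \<le> ?p * (a * \<epsilon> / 2)" using a by (intro mult_left_mono) auto
    also have "\<dots> \<le> real (Suc m)"
      by (rule prob_hybrid_le[OF P n far \<open>\<epsilon> < 1\<close> \<open>0 \<le> a\<close> rate])
    finally have "(10 * ?p) * real (Suc m) \<le> 1 * real (Suc m)" by (simp only: mult_ac mult_1)
    then have "10 * ?p \<le> 1" by (rule mult_right_le_imp_le) simp
    then show ?thesis by simp
  qed
  ultimately show ?thesis by simp
qed

lemma ex_one_sided_test:
  assumes n: "0 < n" and "\<epsilon> < 1" "0 \<le> a"
    and rate: "\<And>\<delta>. 0 \<le> \<delta> \<Longrightarrow> \<delta> \<le> 1 \<Longrightarrow>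
      a * (\<delta> - \<epsilon> / 2) \<le> real c * (1 - (1 - \<delta>) ^ T) + (\<Sum>j\<leftarrow>js. of_bool (1 / 2 ^ Suc j < \<delta>))"
    and a: "20 * real (Suc m) \<le> a * \<epsilon>"
    and K: "real (m * Suc m) * exp (- real K) \<le> 1 / 10"
    and js: "sorted_wrt (\<ge>) js" "\<forall>j\<in>set js. j < L"
  shows "\<exists>A. one_sided_test n \<epsilon> (supported_on_at_most n m) A \<and>
    makes_at_most_queries A (real (query_bound m K c T js (2 ^ L * K)))"
proof -
  let ?I = "replicate_pmf (2 ^ L * K) (pmf_of_set {..<n})"
  let ?S = "replicate_pmf c (replicate_pmf T (pmf_of_set {..<n}))"
  let ?s = "c + length js" and ?q = "query_bound m K c T js (2 ^ L * K)"
  define good where "good = (\<lambda>(I, Ss) t. queries_within ?s n t \<and> depth t \<le> ?q \<and>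
    run t = run (index_tree m K c js I Ss))"
  \<comment> \<open>Memoisation provides only the existence of a shallow equivalent tree, so one is
    chosen for each outcome of the random indices.\<close>
  define tr where "tr = (\<lambda>IS. SOME t. good IS t)"
  define A :: algorithm where "A = (?s, map_pmf tr (pair_pmf ?I ?S))"
  have U: "set_pmf (pmf_of_set {..<n}) = {..<n}" using n by (intro set_pmf_of_set) auto
  have good: "good (I, Ss) (tr (I, Ss))" if "I \<in> set_pmf ?I" "Ss \<in> set_pmf ?S" for I Ss
    unfolding tr_def
  proof (rule someI_ex)
    have "\<exists>t. queries_within ?s n t \<and> depth t \<le> ?q \<and> run t = run (index_tree m K c js I Ss)"
      using that
      by (intro ex_depth_le_card_queried queries_within_index_tree card_queried_index_tree)
        (auto simp: set_replicate_pmf U in_lists_conv_set)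
    then show "\<exists>t. good (I, Ss) t" by (simp add: good_def)
  qed
  have outcome: "outcome A P = map_pmf (\<lambda>R. length R \<le> m) (?I \<bind> (\<lambda>I. ?S \<bind> (\<lambda>Ss.
      map_pmf (real_reps m K c js I Ss) (replicate_pmf ?s P))))" for P
  proof -
    have "outcome A P = ?I \<bind> (\<lambda>I. ?S \<bind> (\<lambda>Ss.
        map_pmf (run (tr (I, Ss))) (Pi_pmf {..<?s} [] (\<lambda>_. P))))"
      by (simp add: outcome_def A_def bind_map_pmf pair_pmf_def bind_assoc_pmf bind_return_pmf map_pmf_def)
    also have "\<dots> = ?I \<bind> (\<lambda>I. ?S \<bind> (\<lambda>Ss.
        map_pmf (\<lambda>xs. length (real_reps m K c js I Ss xs) \<le> m) (replicate_pmf ?s P)))"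
    proof (intro bind_pmf_cong refl)
      fix I Ss assume IS: "I \<in> set_pmf ?I" "Ss \<in> set_pmf ?S"
      have "run (tr (I, Ss)) x \<longleftrightarrow> length (real_reps m K c js I Ss (map x [0..<?s])) \<le> m" for x
        using good[OF IS] IS(2) by (simp add: good_def run_index_tree set_replicate_pmf)
      then show "map_pmf (run (tr (I, Ss))) (Pi_pmf {..<?s} [] (\<lambda>_. P)) =
          map_pmf (\<lambda>xs. length (real_reps m K c js I Ss xs) \<le> m) (replicate_pmf ?s P)"
        unfolding map_Pi_pmf_replicate_pmf[of ?s "[]" P, symmetric] pmf.map_comp
        by (intro map_pmf_cong) auto
    qed
    finally show ?thesis by (simp add: map_bind_pmf pmf.map_comp comp_def)
  qed
  \<comment> \<open>For every choice of indices the representatives are distinct elements of the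
    support, so at most \<open>m\<close> of them can occur.\<close>
  have "pmf (outcome A P) True = 1" if P: "P \<in> supported_on_at_most n m" for P
  proof -
    have fin: "finite (set_pmf P)" and card: "card (set_pmf P) \<le> m"
      using P finite_set_pmf_distributions[of P n] by (auto simp: supported_on_at_most_def)
    have "length (real_reps m K c js I Ss xs) \<le> m" if "xs \<in> set_pmf (replicate_pmf ?s P)" for I Ss xs
    proof -
      have "length (real_reps m K c js I Ss xs) = card (set (real_reps m K c js I Ss xs))"
        by (simp add: distinct_card distinct_real_reps)
      also have "\<dots> \<le> card (set_pmf P)"
        using that set_real_reps[of m K c js I Ss xs]
        by (intro card_mono fin) (auto simp: set_replicate_pmf in_lists_conv_set)
      finally show ?thesis using card by simp
    qed
    then have "set_pmf (outcome A P) \<subseteq> {True}" by (auto simp: outcome)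
    then have "outcome A P = return_pmf True" by (simp add: set_pmf_subset_singleton)
    then show ?thesis by simp
  qed
  moreover have "2 / 3 < pmf (outcome A P) False"
    if "P \<in> distributions n" "far_from n \<epsilon> (supported_on_at_most n m) P" for P
  proof -
    have "pmf (outcome A P) True \<le> 1 / 5"
      using prob_real_reps_le[OF that(1) n that(2) \<open>\<epsilon> < 1\<close> \<open>0 \<le> a\<close> rate a K js]
      by (simp add: outcome pmf_map vimage_def)
    moreover have "pmf (outcome A P) False = 1 - pmf (outcome A P) True" by (rule pmf_False_conv_True)
    ultimately show ?thesis by simp
  qed
  moreover have "is_algorithm n A" "makes_at_most_queries A (real ?q)"
    using good by (auto simp: is_algorithm_def makes_at_most_queries_def A_def good_def)
  ultimately show ?thesis by (intro exI[of _ A]) (simp add: one_sided_test_def)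
qed

section \<open>Choice of parameters\<close>

text \<open>If \<open>1 / 2 ^ L < \<delta>\<close>, some \<open>k < L\<close> satisfies
  \<open>1 / 2 ^ Suc k < \<delta> \<le> 1 / 2 ^ k\<close>, and the summand for \<open>k\<close>
  alone is at least \<delta>.\<close>

lemma dyadic_levels_ge:
  fixes \<delta> :: real
  assumes "\<delta> \<le> 1"
  shows "\<delta> * of_bool (1 / 2 ^ L < \<delta>) \<le> (\<Sum>j<L. 1 / 2 ^ j * of_bool (1 / 2 ^ Suc j < \<delta>))"
proof (induction L)
  case 0
  then show ?case using assms by simp
next
  case (Suc L)
  show ?case
  proof (cases "1 / 2 ^ L < \<delta>")
    case True
    then have "\<delta> \<le> (\<Sum>j<L. 1 / 2 ^ j * of_bool (1 / 2 ^ Suc j < \<delta>))" using Suc by simp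
    moreover have "0 < \<delta>" using True by (rule less_trans[rotated]) simp
    ultimately show ?thesis by (auto simp del: power_Suc intro: add_increasing2)
  next
    case False
    have "0 \<le> (\<Sum>j<L. 1 / 2 ^ j * of_bool (1 / 2 ^ Suc j < \<delta>) :: real)" by (intro sum_nonneg) auto
    with False show ?thesis by (auto simp del: power_Suc)
  qed
qed

text \<open>With \<open>x = T * \<delta>\<close> the chain is
  \<open>exp (- x) \<le> 1 / (1 + x) \<le> 1 - x / 2\<close>, the last step by
  \<open>x \<le> 1\<close>. It makes the yield of a probe linear in its distance.\<close>

lemma one_minus_power_le:
  fixes \<delta> :: real
  assumes "0 \<le> \<delta>" "\<delta> \<le> 1" "real T * \<delta> \<le> 1"
  shows "(1 - \<delta>) ^ T \<le> 1 - real T * \<delta> / 2"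
proof -
  define x where "x = real T * \<delta>"
  have x: "0 \<le> x" "x \<le> 1" using assms by (auto simp: x_def)
  have "(1 - \<delta>) ^ T \<le> exp (- \<delta>) ^ T"
    using exp_ge_add_one_self[of "- \<delta>"] assms by (intro power_mono) auto
  also have "\<dots> = exp (real T * - \<delta>)" by (rule exp_of_nat_mult[symmetric])
  also have "\<dots> = inverse (exp x)" by (simp add: x_def exp_minus)
  also have "\<dots> \<le> inverse (1 + x)" using x exp_ge_add_one_self[of x] by (intro le_imp_inverse_le) auto
  also have "\<dots> \<le> 1 - x / 2"
  proof -
    have "x * x \<le> x * 1" using x by (intro mult_left_mono) auto
    then have "1 \<le> (1 - x / 2) * (1 + x)" by (simp add: field_simps)
    then show ?thesis using x by (simp add: inverse_eq_divide divide_le_eq)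
  qed
  finally show ?thesis by (simp add: x_def)
qed

lemma real_nat_ceiling_le: "0 \<le> x \<Longrightarrow> real (nat \<lceil>x\<rceil>) \<le> x + 1"
  by linarith

text \<open>The reversal puts the finest level first, the order in which prefixes only shrink.
  Sample counts halve as prefixes double, so up to rounding every level costs
  \<open>2 * a * K\<close>.\<close>

definition schedule :: "real \<Rightarrow> nat \<Rightarrow> nat list" where
  "schedule a L = concat (map (\<lambda>j. replicate (nat \<lceil>a / 2 ^ j\<rceil>) j) (rev [0..<L]))"

lemma schedule_Suc: "schedule a (Suc L) = replicate (nat \<lceil>a / 2 ^ L\<rceil>) L @ schedule a L"
  by (simp add: schedule_def)

lemma set_schedule: "j \<in> set (schedule a L) \<Longrightarrow> j < L"
  by (auto simp: schedule_def)

lemma sorted_schedule: "sorted_wrt (\<ge>) (schedule a L)"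
proof (induction L)
  case (Suc L)
  have "sorted_wrt (\<ge>) (replicate k j)" for k and j :: nat by (induction k) auto
  with Suc show ?case
    by (auto simp: schedule_Suc sorted_wrt_append dest!: set_schedule)
qed (simp add: schedule_def)

lemma sum_list_schedule:
  fixes f :: "nat \<Rightarrow> 'a::semiring_1"
  shows "(\<Sum>j\<leftarrow>schedule a L. f j) = (\<Sum>j<L. of_nat (nat \<lceil>a / 2 ^ j\<rceil>) * f j)"
  by (induction L) (simp_all add: schedule_Suc sum_list_replicate add.commute, simp add: schedule_def)

lemma schedule_rate:
  assumes "0 \<le> a" "\<delta> \<le> 1"
  shows "a * (\<delta> * of_bool (1 / 2 ^ L < \<delta>)) \<le> (\<Sum>j\<leftarrow>schedule a L. of_bool (1 / 2 ^ Suc j < \<delta>))"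
proof -
  have "a * (\<delta> * of_bool (1 / 2 ^ L < \<delta>)) \<le> a * (\<Sum>j<L. 1 / 2 ^ j * of_bool (1 / 2 ^ Suc j < \<delta>))"
    by (intro mult_left_mono dyadic_levels_ge assms)
  also have "\<dots> = (\<Sum>j<L. a / 2 ^ j * of_bool (1 / 2 ^ Suc j < \<delta>))"
    by (simp add: sum_distrib_left)
  also have "\<dots> \<le> (\<Sum>j<L. real (nat \<lceil>a / 2 ^ j\<rceil>) * of_bool (1 / 2 ^ Suc j < \<delta>))"
    by (intro sum_mono mult_right_mono real_nat_ceiling_ge) auto
  finally show ?thesis by (simp only: sum_list_schedule)
qed

text \<open>The second summand is the price of rounding up: one extra sample per level, summed
  geometrically.\<close>

lemma schedule_cost:
  assumes "0 \<le> a"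
  shows "real (\<Sum>j\<leftarrow>schedule a L. 2 ^ Suc j * K) \<le> 2 * a * real K * real L + 2 * 2 ^ L * real K"
proof -
  have "(\<Sum>j<L. real (nat \<lceil>a / 2 ^ j\<rceil>) * (2 ^ Suc j * real K)) \<le>
      (\<Sum>j<L. 2 * a * real K + 2 ^ Suc j * real K)"
  proof (intro sum_mono)
    fix j
    have "real (nat \<lceil>a / 2 ^ j\<rceil>) \<le> a / 2 ^ j + 1"
      using assms by (intro real_nat_ceiling_le) auto
    then have "real (nat \<lceil>a / 2 ^ j\<rceil>) * (2 ^ Suc j * real K) \<le> (a / 2 ^ j + 1) * (2 ^ Suc j * real K)"
      by (intro mult_right_mono) auto
    also have "\<dots> = 2 * a * real K + 2 ^ Suc j * real K" by (simp add: field_simps)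
    finally show "real (nat \<lceil>a / 2 ^ j\<rceil>) * (2 ^ Suc j * real K) \<le> 2 * a * real K + 2 ^ Suc j * real K" .
  qed
  also have "\<dots> = 2 * a * real K * real L + (\<Sum>j<L. 2 ^ Suc j) * real K"
    by (simp add: sum.distrib sum_distrib_right)
  also have "(\<Sum>j<L. 2 ^ Suc j :: real) = 2 * 2 ^ L - 2" by (induction L) auto
  also have "(2 * 2 ^ L - 2) * real K \<le> 2 * 2 ^ L * real K" by (intro mult_right_mono) auto
  finally show ?thesis by (simp add: sum_list_schedule)
qed

lemma nat_ceiling_log:
  assumes "1 \<le> x"
  shows "x \<le> 2 ^ nat \<lceil>log 2 x\<rceil>" "2 ^ nat \<lceil>log 2 x\<rceil> \<le> 2 * x"
    "real (nat \<lceil>log 2 x\<rceil>) \<le> log 2 x + 1"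
proof -
  have 0: "0 \<le> log 2 x" using assms by simp
  have pow: "(2::real) ^ k = 2 powr real k" for k by (simp add: powr_realpow)
  have x: "2 powr log 2 x = x" using assms by simp
  show le: "real (nat \<lceil>log 2 x\<rceil>) \<le> log 2 x + 1" using 0 by (rule real_nat_ceiling_le)
  have "2 powr log 2 x \<le> 2 powr real (nat \<lceil>log 2 x\<rceil>)"
    by (intro powr_mono real_nat_ceiling_ge) auto
  then show "x \<le> 2 ^ nat \<lceil>log 2 x\<rceil>" by (simp only: x pow)
  have "2 powr real (nat \<lceil>log 2 x\<rceil>) \<le> 2 powr (log 2 x + 1)" using le by (intro powr_mono) auto
  also have "\<dots> = 2 * x" using x by (simp add: powr_add)
  finally show "2 ^ nat \<lceil>log 2 x\<rceil> \<le> 2 * x" by (simp only: pow)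
qed

text \<open>The factor 6 comes from \<open>10 * m * (m + 1) \<le> m ^ 6\<close>, which at
  \<open>m = 2\<close> reads 60 \<le> 64; passing from base 2 to \<open>exp 1\<close> only
  helps.\<close>

lemma failure_bound:
  assumes "2 \<le> m"
  shows "real (m * Suc m) * exp (- real (nat \<lceil>6 * log 2 (real m)\<rceil>)) \<le> 1 / 10"
proof -
  let ?K = "nat \<lceil>6 * log 2 (real m)\<rceil>"
  have m: "2 \<le> real m" using assms by simp
  have "real m ^ 6 = 2 powr (6 * log 2 (real m))"
  proof -
    have "2 powr (6 * log 2 (real m)) = (2 powr log 2 (real m)) powr 6" by (simp add: powr_powr mult.commute)
    also have "\<dots> = real m powr real 6" using m by simp
    also have "\<dots> = real m ^ 6" using m by (subst powr_realpow) auto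
    finally show ?thesis by simp
  qed
  also have "\<dots> \<le> 2 powr real ?K" by (intro powr_mono real_nat_ceiling_ge) auto
  also have "\<dots> = 2 ^ ?K" by (simp add: powr_realpow)
  also have "\<dots> \<le> exp 1 ^ ?K" using exp_ge_add_one_self[of 1] by (intro power_mono) auto
  also have "\<dots> = exp (real ?K)" by (simp add: exp_of_nat_mult[symmetric])
  finally have "real m ^ 6 \<le> exp (real ?K)" .
  moreover have "10 * (real m * (real m + 1)) \<le> real m ^ 6"
  proof -
    have "2 * real m \<le> real m ^ 2" using m by (simp add: power2_eq_square)
    then have "10 * (real m * (real m + 1)) \<le> 2 ^ 4 * real m ^ 2"
      by (simp add: power2_eq_square distrib_left)
    also have "\<dots> \<le> real m ^ 4 * real m ^ 2" using m by (intro mult_right_mono power_mono) auto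
    also have "\<dots> = real m ^ 6" by (simp flip: power_add)
    finally show ?thesis .
  qed
  ultimately have "10 * (real m * (real m + 1)) \<le> exp (real ?K)" by linarith
  then show ?thesis by (simp add: exp_minus field_simps)
qed

text \<open>Rounding gives \<open>K \<le> 7 * l\<close>. Probing then costs 427, the levels
  \<open>2 * 30 * 7 * 3 = 1260\<close>, their rounding \<open>2 * 4 * 7 = 56\<close>, and the
  representatives \<open>3 / 2 * 4 * 7 = 42\<close>, in units of \<open>X\<close>; the total is
  1785. Only the levels use the factor \<mu>; elsewhere it is bounded below by 1.\<close>

lemma query_bound_le:
  assumes m: "2 \<le> m" and \<epsilon>: "0 < \<epsilon>" "\<epsilon> \<le> 1 / 2"
    and \<mu>: "1 \<le> \<mu>" "real L \<le> 3 * \<mu>" and L: "2 ^ L \<le> 4 / \<epsilon>"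
    and c: "real c * (2 * real (Suc m) + 2 * real T) \<le> 427 * real m / \<epsilon>"
    and K: "K = nat \<lceil>6 * log 2 (real m)\<rceil>"
  shows "real (query_bound m K c T (schedule (30 * real m / \<epsilon>) L) (2 ^ L * K)) \<le>
    1800 * (1 / \<epsilon>) * real m * log 2 (real m) * \<mu>"
proof -
  define l where "l = log 2 (real m)"
  define a where "a = 30 * real m / \<epsilon>"
  define X where "X = (1 / \<epsilon>) * real m * l * \<mu>"
  have l: "1 \<le> l" using m by (simp add: l_def)
  have a: "0 \<le> a" using \<epsilon> by (simp add: a_def)
  have "real K \<le> 6 * l + 1" unfolding K l_def[symmetric] using l by (intro real_nat_ceiling_le) auto
  then have K7: "real K \<le> 7 * l" using l by simp
  have "0 \<le> X" using \<epsilon> l \<mu> by (simp add: X_def)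
  have 1: "2 * a * real K * real L \<le> 1260 * X"
  proof -
    have "2 * a * real K * real L \<le> 2 * a * (7 * l) * (3 * \<mu>)"
      using a K7 \<mu> l by (intro mult_mono) auto
    also have "\<dots> = 1260 * X" by (simp add: a_def X_def)
    finally show ?thesis .
  qed
  have 2: "2 * 2 ^ L * real K \<le> 56 * X"
  proof -
    have "2 * 2 ^ L * real K \<le> 2 * (4 / \<epsilon>) * (7 * l)"
      using L K7 \<epsilon> by (intro mult_mono) auto
    also have "\<dots> = 56 * (1 / \<epsilon> * 1 * l * 1)" by simp
    also have "\<dots> \<le> 56 * X"
      unfolding X_def using \<epsilon> m l \<mu> by (intro mult_mono) auto
    finally show ?thesis .
  qed
  have 3: "real (Suc m) * (2 ^ L * real K) \<le> 42 * X"
  proof -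
    have "real (Suc m) * (2 ^ L * real K) \<le> (3 / 2 * real m) * (4 / \<epsilon> * (7 * l))"
      using m L K7 \<epsilon> by (intro mult_mono) auto
    also have "\<dots> = 42 * (1 / \<epsilon> * real m * l * 1)" by simp
    also have "\<dots> \<le> 42 * X"
      unfolding X_def using \<epsilon> m l \<mu> by (intro mult_mono) auto
    finally show ?thesis .
  qed
  have 4: "real c * (2 * real (Suc m) + 2 * real T) \<le> 427 * X"
  proof -
    have "427 * real m / \<epsilon> = 427 * (1 / \<epsilon> * real m * 1 * 1)" by simp
    also have "\<dots> \<le> 427 * X"
      unfolding X_def using \<epsilon> m l \<mu> by (intro mult_mono) auto
    finally show ?thesis using c by simp
  qed
  have "real (query_bound m K c T (schedule a L) (2 ^ L * K)) =
      real c * (2 * real (Suc m) + 2 * real T) + real (\<Sum>j\<leftarrow>schedule a L. 2 ^ Suc j * K)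
      + real (Suc m) * (2 ^ L * real K)"
    by (simp add: query_bound_def algebra_simps del: power_Suc)
  also have "\<dots> \<le> 427 * X + (1260 * X + 56 * X) + 42 * X"
    using 1 2 3 4 schedule_cost[OF a, of K L] by linarith
  also have "\<dots> \<le> 1800 * X"
    using \<open>0 \<le> X\<close> by simp
  finally show ?thesis by (simp add: a_def X_def l_def mult.assoc)
qed

text \<open>Dimension 0 is separate because no uniform random index exists there. Division by zero
  makes every Hamming distance 0, so nothing is far.\<close>

lemma not_far_from_trivial_cube:
  assumes "1 \<le> m" "0 < \<epsilon>" "\<epsilon> < 1" "P \<in> distributions 0"
  shows "\<not> far_from 0 \<epsilon> (supported_on_at_most 0 m) P"
proof
  assume "far_from 0 \<epsilon> (supported_on_at_most 0 m) P"
  from far_from_imp_expectation_gap[OF assms(4) this, of "[[]]"] assms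
  have "\<epsilon> < measure_pmf.expectation P (gap 0 [[]])" by simp
  moreover have "gap 0 [[]] = (\<lambda>_. 0)" by (simp add: gap_def hamming_dist_def fun_eq_iff)
  ultimately show False using assms by simp
qed

lemma ex_test_trivial_cube:
  assumes "1 \<le> m" "0 < \<epsilon>" "\<epsilon> < 1" "0 \<le> q"
  shows "\<exists>A. one_sided_test 0 \<epsilon> (supported_on_at_most 0 m) A \<and> makes_at_most_queries A q"
proof (intro exI conjI)
  let ?A = "(0, return_pmf (Answer True)) :: algorithm"
  have "outcome ?A P = return_pmf True" for P
    by (simp add: outcome_def bind_return_pmf bind_pmf_const)
  then show "one_sided_test 0 \<epsilon> (supported_on_at_most 0 m) ?A"
    using not_far_from_trivial_cube[OF assms(1-3)] by (auto simp: one_sided_test_def is_algorithm_def)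
qed (use assms in \<open>simp add: makes_at_most_queries_def\<close>)

lemma ex_test_positive_dimension:
  fixes m n :: nat and \<epsilon> :: real
  assumes m: "2 \<le> m" and \<epsilon>: "0 < \<epsilon>" "\<epsilon> \<le> 1 / 2" and n: "0 < n"
  shows "\<exists>A. one_sided_test n \<epsilon> (supported_on_at_most n m) A \<and>
    makes_at_most_queries A
      (1800 * (1 / \<epsilon>) * real m * log 2 (real m) * min (log 2 (1 / \<epsilon>)) (log 2 (real m)))"
proof -
  \<comment> \<open>The factor 30 covers \<open>20 * Suc m\<close>, since
    \<open>Suc m \<le> 3 / 2 * m\<close>; this makes \<open>a * \<epsilon> / 2\<close> at least
    \<open>10 * Suc m\<close>, whence the error \<open>1 / 10\<close>.\<close>
  define a where "a = 30 * real m / \<epsilon>"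
  define K where "K = nat \<lceil>6 * log 2 (real m)\<rceil>"
  define \<mu> where "\<mu> = min (log 2 (1 / \<epsilon>)) (log 2 (real m))"
  have a0: "0 \<le> a" using \<epsilon> by (simp add: a_def)
  have a: "20 * real (Suc m) \<le> a * \<epsilon>" using m \<epsilon> by (simp add: a_def)
  have \<epsilon>2: "2 \<le> 1 / \<epsilon>" using \<epsilon> by (simp add: field_simps)
  have loge: "1 \<le> log 2 (1 / \<epsilon>)" using \<epsilon>2 \<epsilon> by (subst le_log_iff) auto
  have logm: "1 \<le> log 2 (real m)" using m by (subst le_log_iff) auto
  have \<mu>: "1 \<le> \<mu>" using loge logm by (simp add: \<mu>_def)
  \<comment> \<open>Both regimes of \<epsilon> share this reduction: the schedule handles distances
    above \<open>1 / 2 ^ L\<close>, so \<open>rate\<close> is required only below.\<close>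
  have test: ?thesis
    if L: "real L \<le> 3 * \<mu>" "2 ^ L \<le> 4 / \<epsilon>"
      and c: "real c * (2 * real (Suc m) + 2 * real T) \<le> 427 * real m / \<epsilon>"
      and rate: "\<And>\<delta>. 0 \<le> \<delta> \<Longrightarrow> \<delta> \<le> 1 \<Longrightarrow> \<delta> \<le> 1 / 2 ^ L \<Longrightarrow>
        a * (\<delta> - \<epsilon> / 2) \<le> real c * (1 - (1 - \<delta>) ^ T)" for L c T
  proof -
    have "a * (\<delta> - \<epsilon> / 2) \<le> real c * (1 - (1 - \<delta>) ^ T) + (\<Sum>j\<leftarrow>schedule a L. of_bool (1 / 2 ^ Suc j < \<delta>))"
      if \<delta>: "0 \<le> \<delta>" "\<delta> \<le> 1" for \<delta>
    proof -
      have lev: "a * (\<delta> * of_bool (1 / 2 ^ L < \<delta>)) \<le> (\<Sum>j\<leftarrow>schedule a L. of_bool (1 / 2 ^ Suc j < \<delta>))"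
        by (rule schedule_rate[OF a0 \<delta>(2)])
      have "0 \<le> real c * (1 - (1 - \<delta>) ^ T)" using \<delta> by (simp add: power_le_one)
      moreover have "a * (\<delta> - \<epsilon> / 2) \<le> a * \<delta>" using a0 \<epsilon> by (intro mult_left_mono) auto
      ultimately show ?thesis
        using lev rate[OF \<delta>] by (cases "1 / 2 ^ L < \<delta>") (auto simp del: power_Suc)
    qed
    then have "\<exists>A. one_sided_test n \<epsilon> (supported_on_at_most n m) A \<and>
        makes_at_most_queries A (real (query_bound m K c T (schedule a L) (2 ^ L * K)))"
      using n \<epsilon> a0 a failure_bound[OF m] sorted_schedule set_schedule
      unfolding K_def by (intro ex_one_sided_test[where a = a]) auto
    moreover have "real (query_bound m K c T (schedule a L) (2 ^ L * K)) \<le>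
        1800 * (1 / \<epsilon>) * real m * log 2 (real m) * \<mu>"
      unfolding a_def by (rule query_bound_le[OF m \<epsilon> \<mu> L c K_def])
    ultimately show ?thesis unfolding makes_at_most_queries_def \<mu>_def by (meson order_trans)
  qed
  show ?thesis
  proof (cases "1 / \<epsilon> \<le> real m")
    case True
    then have \<mu>_eq: "\<mu> = log 2 (1 / \<epsilon>)" using \<epsilon> m unfolding \<mu>_def by (intro min_absorb1) simp
    \<comment> \<open>The levels reach down to \<open>\<epsilon> / 2\<close>, below which the
      required rate is at most 0; hence no probes. The bound
      \<open>L \<le> log 2 (1 / \<epsilon>) + 2\<close> is where \<open>3 * \<mu>\<close> comes
      from.\<close>
    define L where "L = nat \<lceil>log 2 (2 / \<epsilon>)\<rceil>"
    have "1 \<le> 2 / \<epsilon>" using \<epsilon> by (simp add: field_simps)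
    note L = nat_ceiling_log[OF this, folded L_def]
    have "log 2 (2 / \<epsilon>) = 1 + log 2 (1 / \<epsilon>)" using \<epsilon> by (simp add: log_divide)
    then have "real L \<le> 3 * \<mu>" using L(3) loge \<mu>_eq by simp
    moreover have "2 ^ L \<le> 4 / \<epsilon>" using L(2) by simp
    moreover have "a * (\<delta> - \<epsilon> / 2) \<le> real 0 * (1 - (1 - \<delta>) ^ 0)" if "\<delta> \<le> 1 / 2 ^ L" for \<delta>
    proof -
      have "1 / 2 ^ L \<le> \<epsilon> / 2" using L(1) \<epsilon> by (simp add: field_simps)
      then show ?thesis using that a0 by (simp add: mult_nonneg_nonpos)
    qed
    ultimately show ?thesis using \<epsilon> by (intro test[of L 0 0]) auto
  next
    case False
    then have "real m \<le> 1 / \<epsilon>" by simp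
    then have \<mu>_eq: "\<mu> = log 2 (real m)" using \<epsilon> m unfolding \<mu>_def by (intro min_absorb2) simp
    define L where "L = nat \<lceil>log 2 (real m)\<rceil>"
    \<comment> \<open>The probe length equals the inverse of the level cutoff, so
      \<open>T * \<delta> \<le> 1\<close> holds exactly for the distances left to probing; it lies
      between \<open>m\<close> and \<open>2 * m\<close>.\<close>
    define T :: nat where "T = 2 ^ L"
    \<comment> \<open>A probe detects \<delta> with probability at least
      \<open>T * \<delta> / 2\<close>, so \<open>2 * a / T\<close> of them yield the rate
      \<open>a * \<delta>\<close>.\<close>
    define c where "c = nat \<lceil>2 * a / real T\<rceil>"
    have "1 \<le> real m" using m by simp
    note L = nat_ceiling_log[OF this, folded L_def]
    have T: "real m \<le> real T" "real T \<le> 2 * real m" using L by (auto simp: T_def)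
    have "real L \<le> 3 * \<mu>" using L(3) logm \<mu>_eq by simp
    moreover have "2 ^ L \<le> 4 / \<epsilon>"
    proof -
      have "2 ^ L \<le> 2 * (1 / \<epsilon>)" using L(2) \<open>real m \<le> 1 / \<epsilon>\<close> by linarith
      also have "\<dots> \<le> 4 / \<epsilon>" using \<epsilon> by (simp add: field_simps)
      finally show ?thesis .
    qed
    moreover have "real c * (2 * real (Suc m) + 2 * real T) \<le> 427 * real m / \<epsilon>"
    proof -
      have "real c \<le> 2 * a / real T + 1" unfolding c_def using a0 by (intro real_nat_ceiling_le) auto
      also have "2 * a / real T \<le> 2 * a / real m" using T m a0 by (intro divide_left_mono) auto
      also have "2 * a / real m = 60 / \<epsilon>" using m by (simp add: a_def)
      also have "60 / \<epsilon> + 1 \<le> 61 / \<epsilon>" using \<epsilon> by (simp add: field_simps)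
      finally have "real c \<le> 61 / \<epsilon>" by simp
      \<comment> \<open>The 7 is 3 for \<open>2 * Suc m\<close> plus 4 for \<open>2 * T\<close>;
        with the 61 above it gives 427.\<close>
      moreover have "2 * real (Suc m) + 2 * real T \<le> 7 * real m" using T m by simp
      ultimately have "real c * (2 * real (Suc m) + 2 * real T) \<le> 61 / \<epsilon> * (7 * real m)"
        using \<epsilon> by (intro mult_mono) auto
      then show ?thesis by simp
    qed
    moreover have "a * (\<delta> - \<epsilon> / 2) \<le> real c * (1 - (1 - \<delta>) ^ T)"
      if \<delta>: "0 \<le> \<delta>" "\<delta> \<le> 1" "\<delta> \<le> 1 / 2 ^ L" for \<delta>
    proof -
      have T\<delta>: "real T * \<delta> \<le> 1" using \<delta>(3) by (simp add: T_def field_simps)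
      have "a * (\<delta> - \<epsilon> / 2) \<le> a * \<delta>" using a0 \<epsilon> by (intro mult_left_mono) auto
      also have "\<dots> = 2 * a / real T * (real T * \<delta> / 2)" using T m by simp
      also have "\<dots> \<le> real c * (1 - (1 - \<delta>) ^ T)"
        using one_minus_power_le[OF \<delta>(1,2) T\<delta>] \<delta> unfolding c_def
        by (intro mult_mono real_nat_ceiling_ge) auto
      finally show ?thesis .
    qed
    ultimately show ?thesis by (rule test)
  qed
qed

theorem theorem7p9:
  "\<exists>C::real. C > 0 \<and>
     (\<forall>(m::nat) (\<epsilon>::real) (n::nat). m \<ge> 2 \<longrightarrow> 0 < \<epsilon> \<longrightarrow> \<epsilon> \<le> 1 / 2 \<longrightarrow>
        (\<exists>A. one_sided_test n \<epsilon> (supported_on_at_most n m) A \<and>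
             makes_at_most_queries A
               (C * (1 / \<epsilon>) * real m * log 2 (real m) * min (log 2 (1 / \<epsilon>)) (log 2 (real m)))))"
proof (intro exI[of _ 1800] conjI allI impI)
  fix m n :: nat and \<epsilon> :: real
  assume *: "2 \<le> m" "0 < \<epsilon>" "\<epsilon> \<le> 1 / 2"
  show "\<exists>A. one_sided_test n \<epsilon> (supported_on_at_most n m) A \<and>
      makes_at_most_queries A
        (1800 * (1 / \<epsilon>) * real m * log 2 (real m) * min (log 2 (1 / \<epsilon>)) (log 2 (real m)))"
  proof (cases "n = 0")
    case True
    have "0 \<le> min (log 2 (1 / \<epsilon>)) (log 2 (real m))" using * by (simp add: field_simps)
    then show ?thesis unfolding True using * by (intro ex_test_trivial_cube) auto
  next
    case False
    then show ?thesis using ex_test_positive_dimension[OF *] by simp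
  qed
qed simp

end
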